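(* Let $m\geq 2$, let $0<r<1$, let $l_1,\ldots,l_m$ be positive integers with $\gcd(l_1,\ldots,l_m)=1$, let $a_1,\ldots,a_m\in\mathbb{R}$, and consider the iterated function system $f_i(x)=r^{l_i}x+a_i$, $1\leq i\leq m$, on $\mathbb{R}$. Let $(p_1,\ldots,p_m)$ be a probability vector with $\sum_{i=1}^m p_i=1$ and $0<p_i<1$ for all $1\leq i\leq m$, and let $\mu$ be the associated self-similar measure. Assume that $\mu$ is non-atomic. Suppose that $r^{-1}$ is an algebraic number which has at least one conjugate different from itself outside the unit circle (i.e. of absolute value $>1$). Then there exists a constant $\gamma>0$ such that $$|\widehat{\mu}(u)|=O\big((\log|u|)^{-\gamma}\big)\quad (|u|\to\infty).$$ Furthermore, $\mu$-almost every $x$ is normal to every integer base $b\geq 2$.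
   Context: The self-similar measure associated with $f_1,\ldots,f_m$ and $(p_1,\ldots,p_m)$ is the unique Borel probability measure $\mu$ supported on the self-similar set $K$ (the unique nonempty compact $K\subset\mathbb{R}$ with $K=\bigcup_{i=1}^m f_i(K)$) satisfying $\mu=\sum_{i=1}^m p_i f_i\mu$, where $f\mu:=\mu\circ f^{-1}$ is the push-forward of $\mu$ by $f$. The Fourier transform of $\mu$ is $\widehat{\mu}(u)=\int_{\mathbb{R}}\exp(2\pi i u t)\,d\mu(t)$ for $u\in\mathbb{R}$. The conjugates of an algebraic number are the complex roots of its minimal polynomial over $\mathbb{Q}$. A real number $x$ is normal to an integer base $b\geq 2$ if the sequence $(x b^n)_{n\geq 1}$ is uniformly distributed modulo one, i.e. for every subinterval $I\subset[0,1]$ one has $\lim_{N\to\infty}\frac1N\#\{1\leq n\leq N: x b^n \bmod 1\in I\}=|I|$, where $|I|$ is the length of $I$. *)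

theory Defs
  imports
    "HOL-Probability.Probability"
    "HOL-Computational_Algebra.Computational_Algebra"
    "HOL-Library.Landau_Symbols"
begin

definition is_self_similar_set :: "'i set \<Rightarrow> ('i \<Rightarrow> real \<Rightarrow> real) \<Rightarrow> real set \<Rightarrow> bool" where
  "is_self_similar_set I f K \<longleftrightarrow> compact K \<and> K \<noteq> {} \<and> K = (\<Union>i\<in>I. f i ` K)"

(* For a finite nonempty family of contractions and a probability vector p there is exactly
   one such K and exactly one such M, so a statement about an arbitrary M satisfying this
   predicate is a statement about the self-similar measure.  "Supported on K" means that the
   complement of K is a null set. *)
definition is_self_similar_measure ::
    "'i set \<Rightarrow> ('i \<Rightarrow> real \<Rightarrow> real) \<Rightarrow> ('i \<Rightarrow> real) \<Rightarrow> real measure \<Rightarrow> bool" where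
  "is_self_similar_measure I f p M \<longleftrightarrow>
     prob_space M \<and> sets M = sets borel \<and>
     (\<exists>K. is_self_similar_set I f K \<and> emeasure M (- K) = 0) \<and>
     (\<forall>A\<in>sets borel. measure M A = (\<Sum>i\<in>I. p i * measure (distr M borel (f i)) A))"

definition non_atomic :: "real measure \<Rightarrow> bool" where
  "non_atomic M \<longleftrightarrow> (\<forall>x. emeasure M {x} = 0)"

(* This is char M (2 * pi * u): the library's characteristic function does not have the
   factor 2 * pi in the exponent. *)
definition fourier_transform :: "real measure \<Rightarrow> real \<Rightarrow> complex" where
  "fourier_transform M u = (CLINT t|M. iexp (2 * pi * u * t))"

(* For algebraic z such a polynomial exists and is unique; otherwise there is none. *)
definition is_minimal_polynomial :: "complex \<Rightarrow> rat poly \<Rightarrow> bool" where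
  "is_minimal_polynomial z q \<longleftrightarrow>
     lead_coeff q = 1 \<and> irreducible q \<and> poly (map_poly of_rat q) z = 0"

definition conjugates :: "complex \<Rightarrow> complex set" where
  "conjugates z = {w. \<exists>q. is_minimal_polynomial z q \<and> poly (map_poly of_rat q) w = 0}"

(* is_interval covers open, closed, half-open and degenerate intervals alike. *)
definition normal_to_base :: "nat \<Rightarrow> real \<Rightarrow> bool" where
  "normal_to_base b x \<longleftrightarrow>
     (\<forall>J. is_interval J \<and> J \<subseteq> {0..1} \<longrightarrow>
        (\<lambda>N. real (card {n\<in>{1..N}. frac (x * real b ^ n) \<in> J}) / real N)
          \<longlonglongrightarrow> measure lborel J)"

end

theory Submission
  imports Defs
begin

text \<open>
Write \<open>\<theta> = 1 / r\<close> and let \<open>F\<close> be the Fourier transform of the measure. Self-similarity says that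
\<open>F (v) = (\<Sum>i. p i * exp (2 \<pi> \<i> a i v) * F (r ^ l i * v))\<close>, so that along a geometric progression
\<open>G k = \<bar>F (w * \<theta> ^ k)\<bar>\<close> satisfies the renewal inequality \<open>G k \<le> (\<Sum>i. p i * G (k - l i))\<close>.

The gain over the trivial bound comes from two words of equal length. As the measure has no atoms,
two of the maps have distinct fixed points, and for these the compositions \<open>f i \<circ> f j\<close> and
\<open>f j \<circ> f i\<close> have the same contraction ratio but translation parts that differ by some \<open>\<alpha> \<noteq> 0\<close>. In
\<open>F (v)\<close> their contributions carry the phase difference \<open>\<alpha> * v\<close>, and partly cancel unless \<open>\<alpha> * v\<close> is
close to an integer (\<open>two_word_gain\<close>).

It remains to find scales \<open>k\<close> at which \<open>\<alpha> * w * \<theta> ^ k\<close> is not close to an integer. On a run of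
consecutive bad scales the nearest integers obey the linear recurrence whose characteristic
polynomial is the minimal polynomial of \<open>\<theta>\<close>. Projecting to the eigenvalue \<open>z\<close>, the given conjugate,
kills the progression itself, so it leaves only rounding errors, which are bounded; but it also
multiplies by \<open>z\<close> at every step. As \<open>\<bar>z\<bar> > 1\<close>, the projection at the start of a long run is
exponentially small in the length of the run, while it is a nonzero integer polynomial of
controlled height evaluated at \<open>z\<close>, hence at least a constant times a fixed power of \<open>r ^ A\<close> if the
run starts at \<open>A\<close> (\<open>coprime_int_polys_lower_bound\<close>). Such a run therefore has length \<open>O (A + 1)\<close>
(\<open>bad_run_length\<close>).

Since the \<open>l i\<close> have greatest common divisor 1, a gain at one scale spreads to all sufficiently
later scales (\<open>renewal_gain_propagates\<close>). So \<open>sup G\<close> over \<open>k \<ge> D * (A + 1)\<close> is smaller by a fixed factor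
than \<open>sup G\<close> over \<open>k \<ge> A\<close>. This happens once per multiplication of \<open>k\<close> by a constant, which yields
power decay in \<open>k\<close>, that is, decay as a power of \<open>log \<bar>u\<bar>\<close> in the frequency \<open>u\<close>.

Normality is the Davenport-Erdos-LeVeque argument. The functions \<open>exp (2 \<pi> \<i> h b ^ n x)\<close> have
correlations \<open>F (h * (b ^ m - b ^ n))\<close>, which are \<open>O (m powr - \<gamma>)\<close> because the frequency is exponential in
\<open>m\<close>. Hence the averages of the first \<open>N\<close> of them have second moment \<open>O (N powr - \<gamma>)\<close>. This is summable
along \<open>N = k ^ q\<close>, and averages change little between consecutive such \<open>N\<close>, so they tend to 0 almost
everywhere. The Weyl criterion, applied for the countably many pairs of \<open>b\<close> and \<open>h\<close>, concludes.
\<close>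

section \<open>Integer polynomials at an algebraic point\<close>

lemma nonzero_integer_constant_poly_ge_1:
  fixes F :: "complex poly"
  assumes int: "\<And>i. coeff F i \<in> \<int>" and deg: "degree F = 0" and nz: "F \<noteq> 0"
  shows "1 \<le> cmod (poly F z)"
proof -
  obtain a where F: "F = [:a:]" using deg degree_0_id by metis
  have "a \<in> \<int>" using int[of 0] F by simp
  moreover have "a \<noteq> 0" using nz F by auto
  ultimately obtain b :: int where "a = of_int b" "b \<noteq> 0" by (auto elim: Ints_cases)
  then have "1 \<le> cmod a" by simp
  then show ?thesis using F by simp
qed

lemma no_root_imp_degree_0:
  fixes F :: "complex poly"
  assumes "\<And>w. poly F w \<noteq> 0"
  shows "degree F = 0"
  using assms fundamental_theorem_of_algebra[of F] constant_degree[of F] by blast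

text \<open>One step of Euclid's algorithm over the integers: the leading term of \<open>F\<close> is cancelled by
cross-multiplication with the leading coefficients, so no denominators appear. The height at most
squares, up to a factor 2, and the value at \<open>z\<close> stays comparable to those of \<open>F\<close> and \<open>G\<close>.\<close>

lemma pseudo_euclid_step:
  fixes F G :: "complex poly"
  assumes G0: "G \<noteq> 0" and deg: "degree G \<le> degree F" and degF: "0 < degree F"
    and intF: "\<And>i. coeff F i \<in> \<int>" and intG: "\<And>i. coeff G i \<in> \<int>"
    and nr: "\<And>w. \<not> (poly F w = 0 \<and> poly G w = 0)"
    and H: "1 \<le> H" and hF: "\<And>i. cmod (coeff F i) \<le> H" and hG: "\<And>i. cmod (coeff G i) \<le> H"
  obtains F' where "degree F' < degree F" "\<And>i. coeff F' i \<in> \<int>"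
    "\<And>w. \<not> (poly F' w = 0 \<and> poly G w = 0)" "\<And>i. cmod (coeff F' i) \<le> 2 * H\<^sup>2"
    "cmod (poly F' z) \<le> H * (1 + (1 + cmod z) ^ degree F) * max (cmod (poly F z)) (cmod (poly G z))"
proof -
  define k where "k = degree F - degree G"
  define F' where "F' = smult (lead_coeff G) F - smult (lead_coeff F) (monom 1 k * G)"
  have coeff: "coeff F' i = lead_coeff G * coeff F i - lead_coeff F * (if i < k then 0 else coeff G (i - k))" for i
    by (simp add: F'_def coeff_monom_mult)
  have val: "poly F' w = lead_coeff G * poly F w - lead_coeff F * (w ^ k * poly G w)" for w
    by (simp add: F'_def poly_monom)
  have "coeff F' i = 0" if "i \<ge> degree F" for i
  proof (cases "i = degree F")
    case True
    have "degree F - k = degree G" using deg by (simp add: k_def)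
    then show ?thesis using True deg by (simp add: coeff k_def)
  next
    case False
    then have "i > degree F" "i - k > degree G" "\<not> i < k" using that deg by (auto simp: k_def)
    then show ?thesis by (simp add: coeff coeff_eq_0)
  qed
  then have 1: "degree F' < degree F"
    using degF by (metis leading_coeff_0_iff degree_0 not_le)
  have 2: "coeff F' i \<in> \<int>" for i
    using intF intG by (auto simp: coeff intro!: Ints_diff Ints_mult)
  have 3: "\<not> (poly F' w = 0 \<and> poly G w = 0)" for w
    using nr[of w] G0 by (auto simp: val)
  have 4: "cmod (coeff F' i) \<le> 2 * H\<^sup>2" for i
  proof -
    have "cmod (coeff F' i) \<le> cmod (lead_coeff G * coeff F i) + cmod (lead_coeff F * (if i < k then 0 else coeff G (i - k)))"
      unfolding coeff by (rule norm_triangle_ineq4)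
    also have "\<dots> \<le> H * H + H * H"
      unfolding norm_mult using hF hG H by (intro add_mono mult_mono) auto
    finally show ?thesis by (simp add: power2_eq_square)
  qed
  define m where "m = max (cmod (poly F z)) (cmod (poly G z))"
  have m0: "0 \<le> m" by (auto simp: m_def le_max_iff_disj)
  \<comment> \<open>the base \<open>1 + cmod z\<close> instead of \<open>cmod z\<close> makes the power increase with the exponent\<close>
  have zk: "cmod z ^ k \<le> (1 + cmod z) ^ degree F"
  proof -
    have "cmod z ^ k \<le> (1 + cmod z) ^ k" by (intro power_mono) auto
    also have "\<dots> \<le> (1 + cmod z) ^ degree F" by (intro power_increasing) (auto simp: k_def)
    finally show ?thesis .
  qed
  have "cmod (poly F' z) \<le> cmod (lead_coeff G * poly F z) + cmod (lead_coeff F * (z ^ k * poly G z))"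
    unfolding val by (rule norm_triangle_ineq4)
  also have "\<dots> \<le> H * m + H * ((1 + cmod z) ^ degree F * m)"
    unfolding norm_mult norm_power using hF hG H m0 zk
    by (intro add_mono mult_mono) (auto simp: m_def)
  also have "\<dots> = H * (1 + (1 + cmod z) ^ degree F) * m" by (simp add: algebra_simps)
  finally have 5: "cmod (poly F' z) \<le> H * (1 + (1 + cmod z) ^ degree F) * m" .
  show thesis using that[OF 1 2 3 4 5[unfolded m_def]] .
qed

text \<open>A Liouville inequality: two integer polynomials without a common root cannot both be very small
at \<open>z\<close>. Euclid's algorithm takes boundedly many steps to reach a nonzero integer constant, each step
raises the height to at most a fixed power, and going back each step loses at most a power of the
height. The exponent \<open>K\<close> obtained is exponential in the degree, but any exponent that depends on
the degree alone gives logarithmic decay in the end.\<close>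

lemma coprime_int_polys_lower_bound:
  fixes z :: complex
  shows "\<exists>c>0. \<exists>K::nat. \<forall>F G H. degree F + degree G \<le> n \<longrightarrow>
    (\<forall>i. coeff F i \<in> \<int> \<and> coeff G i \<in> \<int>) \<longrightarrow>
    (\<forall>w. \<not> (poly F w = 0 \<and> poly G w = 0)) \<longrightarrow> 1 \<le> H \<longrightarrow>
    (\<forall>i. cmod (coeff F i) \<le> H \<and> cmod (coeff G i) \<le> H) \<longrightarrow>
    c / H ^ K \<le> max (cmod (poly F z)) (cmod (poly G z))"
proof (induction n)
  case 0
  show ?case
  proof (rule exI[of _ 1], intro conjI exI[of _ 0] allI impI)
    fix F G :: "complex poly" and H :: real
    assume deg: "degree F + degree G \<le> 0" and int: "\<forall>i. coeff F i \<in> \<int> \<and> coeff G i \<in> \<int>"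
      and nr: "\<forall>w. \<not> (poly F w = 0 \<and> poly G w = 0)"
    have "F \<noteq> 0 \<or> G \<noteq> 0" using nr by auto
    then show "1 / H ^ 0 \<le> max (cmod (poly F z)) (cmod (poly G z))"
      using nonzero_integer_constant_poly_ge_1[of F z] nonzero_integer_constant_poly_ge_1[of G z] deg int
      by (auto simp: le_max_iff_disj)
  qed simp
next
  case (Suc n)
  then obtain c K where c: "c > 0" and IH: "\<And>F G H. degree F + degree G \<le> n \<Longrightarrow>
    (\<forall>i. coeff F i \<in> \<int> \<and> coeff G i \<in> \<int>) \<Longrightarrow>
    (\<forall>w. \<not> (poly F w = 0 \<and> poly G w = 0)) \<Longrightarrow> 1 \<le> H \<Longrightarrow>
    (\<forall>i. cmod (coeff F i) \<le> H \<and> cmod (coeff G i) \<le> H) \<Longrightarrow>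
    c / H ^ K \<le> max (cmod (poly F z)) (cmod (poly G z))" by metis
  define B where "B = 1 + (1 + cmod z) ^ Suc n"
  have B1: "1 \<le> B" by (simp add: B_def)
  define c' where "c' = min 1 (c / (2 ^ K * B))"
  have c'0: "0 < c'" using c B1 by (simp add: c'_def)
  \<comment> \<open>the roles of the two polynomials are symmetric, so the one of smaller degree may come second\<close>
  have main: "c' / H ^ (2 * K + 1) \<le> max (cmod (poly F z)) (cmod (poly G z))"
    if deg: "degree F + degree G \<le> Suc n" and le: "degree G \<le> degree F"
      and int: "\<forall>i. coeff F i \<in> \<int> \<and> coeff G i \<in> \<int>"
      and nr: "\<forall>w. \<not> (poly F w = 0 \<and> poly G w = 0)" and H: "1 \<le> H"
      and ht: "\<forall>i. cmod (coeff F i) \<le> H \<and> cmod (coeff G i) \<le> H" for F G H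
  proof -
    have H': "1 \<le> H ^ (2 * K + 1)" using H by (rule one_le_power)
    have triv: "c' / H ^ (2 * K + 1) \<le> 1"
      using H' c'0 by (simp add: divide_le_eq c'_def)
    consider "degree F = 0" | "0 < degree F" "G = 0" | "0 < degree F" "G \<noteq> 0" by auto
    then show ?thesis
    proof cases
      case 1
      then have "degree G = 0" using le by simp
      moreover have "F \<noteq> 0 \<or> G \<noteq> 0" using nr by auto
      ultimately have "1 \<le> max (cmod (poly F z)) (cmod (poly G z))"
        using 1 nonzero_integer_constant_poly_ge_1[of F z] nonzero_integer_constant_poly_ge_1[of G z] int
        by (auto simp: le_max_iff_disj)
      then show ?thesis using triv by linarith
    next
      case 2
      then show ?thesis using no_root_imp_degree_0[of F] nr by auto
    next
      case 3
      obtain F' where F': "degree F' < degree F" "\<And>i. coeff F' i \<in> \<int>"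
        "\<And>w. \<not> (poly F' w = 0 \<and> poly G w = 0)" "\<And>i. cmod (coeff F' i) \<le> 2 * H\<^sup>2"
        "cmod (poly F' z) \<le> H * (1 + (1 + cmod z) ^ degree F) * max (cmod (poly F z)) (cmod (poly G z))"
        using pseudo_euclid_step[of G F H z] 3 le int nr H ht by metis
      define m where "m = max (cmod (poly F z)) (cmod (poly G z))"
      have m0: "0 \<le> m" by (auto simp: m_def le_max_iff_disj)
      have HB: "1 \<le> H * B" using mult_mono[OF H B1] H by simp
      have "(1 + cmod z) ^ degree F \<le> (1 + cmod z) ^ Suc n"
        using deg by (intro power_increasing) auto
      then have "H * (1 + (1 + cmod z) ^ degree F) * m \<le> H * B * m"
        using H m0 unfolding B_def by (intro mult_right_mono mult_left_mono) auto
      then have 1: "cmod (poly F' z) \<le> H * B * m" using F'(5) unfolding m_def by linarith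
      have "cmod (poly G z) \<le> m" by (simp add: m_def)
      also have "m \<le> H * B * m" using mult_right_mono[OF HB m0] by simp
      finally have 2: "max (cmod (poly F' z)) (cmod (poly G z)) \<le> H * B * m" using 1 by simp
      have HH: "H \<le> 2 * H\<^sup>2" using self_le_power[OF H, of 2] H by simp
      have "c / (2 * H\<^sup>2) ^ K \<le> max (cmod (poly F' z)) (cmod (poly G z))"
      proof (rule IH)
        show "\<forall>i. cmod (coeff F' i) \<le> 2 * H\<^sup>2 \<and> cmod (coeff G i) \<le> 2 * H\<^sup>2"
          using F'(4) ht HH by (meson order_trans)
      qed (use F' int deg H HH in auto)
      then have "c / (2 * H\<^sup>2) ^ K \<le> H * B * m" using 2 by linarith
      then have "c \<le> (2 * H\<^sup>2) ^ K * (H * B * m)"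
        using H by (simp add: divide_le_eq mult.commute)
      also have "\<dots> = (2 ^ K * B) * (H ^ (2 * K + 1) * m)"
        by (simp add: power_mult_distrib power_mult[symmetric] power_add)
      finally have "c / (2 ^ K * B) \<le> H ^ (2 * K + 1) * m"
        using B1 by (simp add: divide_le_eq mult.commute)
      then have "c' \<le> H ^ (2 * K + 1) * m" by (simp add: c'_def)
      then show ?thesis using H' unfolding m_def[symmetric]
        by (simp add: divide_le_eq mult.commute)
    qed
  qed
  show ?case
  proof (rule exI[of _ c'], intro conjI exI[of _ "2 * K + 1"] allI impI c'0)
    fix F G :: "complex poly" and H :: real
    assume h: "degree F + degree G \<le> Suc n" "\<forall>i. coeff F i \<in> \<int> \<and> coeff G i \<in> \<int>"
      "\<forall>w. \<not> (poly F w = 0 \<and> poly G w = 0)" "1 \<le> H"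
      "\<forall>i. cmod (coeff F i) \<le> H \<and> cmod (coeff G i) \<le> H"
    show "c' / H ^ (2 * K + 1) \<le> max (cmod (poly F z)) (cmod (poly G z))"
    proof (cases "degree G \<le> degree F")
      case True
      then show ?thesis using main[of F G H] h by auto
    next
      case False
      then have "c' / H ^ (2 * K + 1) \<le> max (cmod (poly G z)) (cmod (poly F z))"
        using main[of G F H] h by (auto simp: add.commute)
      then show ?thesis by (simp add: max.commute)
    qed
  qed
qed

lemma poly_of_rat_add:
  "poly (map_poly of_rat (p + q)) (w::complex) = poly (map_poly of_rat p) w + poly (map_poly of_rat q) w"
proof -
  have "map_poly of_rat (p + q) = map_poly of_rat p + (map_poly of_rat q :: complex poly)"
    by (intro poly_eqI) (simp add: coeff_map_poly of_rat_add)
  then show ?thesis by simp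
qed

lemma poly_of_rat_mult:
  "poly (map_poly of_rat (p * q)) (w::complex) = poly (map_poly of_rat p) w * poly (map_poly of_rat q) w"
proof (induction p)
  case (pCons a p)
  have "map_poly of_rat (smult a q) = smult (of_rat a) (map_poly of_rat q :: complex poly)"
    by (intro poly_eqI) (simp add: coeff_map_poly of_rat_mult)
  then show ?case using pCons
    by (simp add: poly_of_rat_add map_poly_pCons algebra_simps)
qed auto

text \<open>If \<open>R\<close> had the root \<open>w\<close> then so would the remainder of \<open>q\<close> modulo \<open>R\<close>; by descent on the degree this
remainder is 0, so \<open>R\<close> would be a proper factor of \<open>q\<close>.\<close>

lemma irreducible_no_common_root:
  fixes q :: "rat poly" and w :: complex
  assumes irr: "irreducible q" and R: "R \<noteq> 0" "degree R < degree q"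
    and root: "poly (map_poly of_rat q) w = 0"
  shows "poly (map_poly of_rat R) w \<noteq> 0"
  using R
proof (induction "degree R" arbitrary: R rule: less_induct)
  case less
  have R0: "R \<noteq> 0" and degR: "degree R < degree q" using less.prems by auto
  show ?case
  proof
    assume Rw: "poly (map_poly of_rat R) w = 0"
    define t where "t = q mod R"
    have q: "q = (q div R) * R + t" by (simp add: t_def)
    have "poly (map_poly of_rat t) w = 0"
      using root Rw arg_cong[OF q, of "\<lambda>p. poly (map_poly of_rat p) w"]
      by (simp add: poly_of_rat_add poly_of_rat_mult)
    then have "t = 0"
      using degree_mod_less[OF R0, of q] less.hyps[of t] degR unfolding t_def by auto
    then have qR: "q = (q div R) * R" using q by simp
    have "q div R dvd 1 \<or> R dvd 1" using irr qR by (rule irreducibleD)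
    then show False
    proof
      assume "q div R dvd 1"
      then obtain S where S: "(q div R) * S = 1" by (metis dvdE)
      then have nz: "q div R \<noteq> 0" "S \<noteq> 0" by auto
      have "degree (q div R) + degree S = 0"
        using S degree_mult_eq[OF nz] by simp
      then have "degree q = degree R"
        using degree_mult_eq[OF nz(1) R0] qR by simp
      then show False using degR by simp
    next
      assume "R dvd 1"
      then obtain S where "R * S = 1" by (metis dvdE)
      then have "poly (map_poly of_rat R) w * poly (map_poly of_rat S) w = 1"
        using poly_of_rat_mult[of R S w] by simp
      then show False using Rw by simp
    qed
  qed
qed

section \<open>Geometric progressions close to the integers\<close>

lemma poly_shift_Suc: "poly_shift j P = pCons (coeff P j) (poly_shift (Suc j) P)"
  by (intro poly_eqI) (simp add: coeff_poly_shift coeff_pCons split: nat.split)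

text \<open>The numbers \<open>t j\<close> are the coefficients of \<open>P / (X - z)\<close>, obtained by Horner's scheme as values of the
truncated polynomials \<open>poly_shift (Suc j) P\<close>. Thus the statement is the factorization
\<open>P = (X - z) * (P / (X - z))\<close> with \<open>X\<close> read as the shift operator on sequences. Writing \<open>t j\<close> as a value at \<open>z\<close>
of an integer polynomial is what later turns the projection into an integer polynomial at \<open>z\<close>.\<close>

lemma shift_operator_telescope:
  fixes P :: "complex poly" and y :: "nat \<Rightarrow> complex" and z :: complex
  defines "t \<equiv> \<lambda>j. poly (poly_shift (Suc j) P) z"
  assumes root: "poly P z = 0"
  shows "(\<Sum>j<degree P. t j * y (Suc j)) - z * (\<Sum>j<degree P. t j * y j) = (\<Sum>j\<le>degree P. coeff P j * y j)"
proof -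
  define d where "d = degree P"
  have td: "t d = 0"
  proof -
    have "poly_shift (Suc d) P = 0"
      by (intro poly_eqI) (simp add: coeff_poly_shift d_def coeff_eq_0)
    then show ?thesis by (simp add: t_def)
  qed
  have tS: "t j = coeff P (Suc j) + z * t (Suc j)" for j
    unfolding t_def by (subst poly_shift_Suc) simp
  have t0: "coeff P 0 = - z * t 0"
    using root unfolding t_def
    by (subst (asm) poly_shift_id[symmetric, THEN fun_cong], subst (asm) poly_shift_Suc)
       (simp add: eq_neg_iff_add_eq_0)
  have "(\<Sum>j<n. t j * y (Suc j)) - z * (\<Sum>j<n. t j * y j)
      = (\<Sum>j\<le>n. coeff P j * y j) + z * t n * y n" for n
  proof (induction n)
    case 0
    show ?case using t0 by simp
  next
    case (Suc n)
    have "(\<Sum>j<Suc n. t j * y (Suc j)) - z * (\<Sum>j<Suc n. t j * y j)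
      = ((\<Sum>j<n. t j * y (Suc j)) - z * (\<Sum>j<n. t j * y j)) + t n * y (Suc n) - z * t n * y n"
      by (simp add: algebra_simps)
    also have "\<dots> = (\<Sum>j\<le>n. coeff P j * y j) + t n * y (Suc n)"
      using Suc by simp
    also have "\<dots> = (\<Sum>j\<le>Suc n. coeff P j * y j) + z * t (Suc n) * y (Suc n)"
      by (subst tS) (simp add: algebra_simps)
    finally show ?case .
  qed
  from this[of d] show ?thesis using td by (simp add: d_def)
qed

text \<open>The choice of \<open>\<epsilon>\<close> makes \<open>\<Sum>j. coeff P j * N (k + j)\<close> an integer of absolute value below 1 when all
terms involved are within \<open>\<epsilon>\<close> of their nearest integers \<open>N\<close>, so the integers \<open>N\<close> satisfy the recurrence
exactly. Then \<open>\<Lambda> k = (\<Sum>j. t j * N (k + j))\<close> is multiplied by \<open>z\<close> at each step of the run, while it stays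
bounded because the same combination of the exact progression vanishes (here \<open>z \<noteq> \<theta>\<close> enters).
Comparing with the Liouville bound for \<open>\<Lambda> A\<close>, whose height is of order \<open>\<theta> ^ A\<close>, bounds the length.\<close>

lemma bad_run_length:
  fixes P :: "complex poly" and \<theta> :: real and z :: complex
  assumes int: "\<And>i. coeff P i \<in> \<int>" and P0: "P \<noteq> 0"
    and irr: "\<And>R w. \<lbrakk>\<And>i. coeff R i \<in> \<int>; R \<noteq> 0; degree R < degree P; poly P w = 0\<rbrakk> \<Longrightarrow> poly R w \<noteq> 0"
    and \<theta>: "1 < \<theta>" "poly P (of_real \<theta>) = 0"
    and z: "1 < cmod z" "z \<noteq> of_real \<theta>" "poly P z = 0"
  shows "\<exists>\<epsilon>>0. \<exists>C::nat. \<forall>x0 A n. 1 \<le> \<bar>x0\<bar> \<longrightarrow> \<bar>x0\<bar> \<le> \<theta> \<longrightarrow>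
     (\<forall>k\<in>{A..A+n}. \<bar>x0 * \<theta> ^ k - of_int (round (x0 * \<theta> ^ k))\<bar> < \<epsilon>) \<longrightarrow> n \<le> C * (A + 1)"
proof -
  define d where "d = degree P"
  define t where "t = (\<lambda>j. poly (poly_shift (Suc j) P) z)"
  define S where "S = (\<Sum>j\<le>d. cmod (coeff P j))"
  define T where "T = 1 + (\<Sum>j<d. cmod (t j))"
  have S0: "0 \<le> S" by (auto simp: S_def intro: sum_nonneg)
  have T1: "1 \<le> T" by (auto simp: T_def intro: sum_nonneg)
  have coeff_le_S: "cmod (coeff P j) \<le> S" for j
  proof (cases "j \<le> d")
    case True
    then show ?thesis unfolding S_def by (intro member_le_sum) auto
  next
    case False
    then show ?thesis using S0 by (simp add: d_def coeff_eq_0)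
  qed
  have d1: "1 \<le> d"
  proof (rule ccontr)
    assume "\<not> 1 \<le> d"
    then obtain a where "P = [:a:]" using degree_0_id[of P] by (metis d_def less_one not_le)
    then show False using z P0 by auto
  qed
  define \<epsilon> where "\<epsilon> = 1 / (2 * (S + 1))"
  have \<epsilon>: "0 < \<epsilon>" "\<epsilon> \<le> 1 / 2" "\<epsilon> * S < 1"
    using S0 by (auto simp: \<epsilon>_def divide_simps)
  obtain c K where c: "c > 0" and low: "\<And>F G H. degree F + degree G \<le> 2 * d \<Longrightarrow>
    (\<forall>i. coeff F i \<in> \<int> \<and> coeff G i \<in> \<int>) \<Longrightarrow>
    (\<forall>w. \<not> (poly F w = 0 \<and> poly G w = 0)) \<Longrightarrow> 1 \<le> H \<Longrightarrow>
    (\<forall>i. cmod (coeff F i) \<le> H \<and> cmod (coeff G i) \<le> H) \<Longrightarrow>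
    c / H ^ K \<le> max (cmod (poly F z)) (cmod (poly G z))"
    using coprime_int_polys_lower_bound[of "2 * d" z] by metis
  define D where "D = real (d + 1) * (\<theta> ^ (d + 1) + 1) * (S + 1)"
  have D1: "1 \<le> D" "S \<le> D"
  proof -
    have "1 \<le> real (d + 1) * (\<theta> ^ (d + 1) + 1)"
      using \<theta> mult_mono[of 1 "real (d+1)" 1 "\<theta> ^ (d + 1) + 1"] by simp
    then have "1 * (S + 1) \<le> D" unfolding D_def using S0 by (intro mult_right_mono) auto
    then show "1 \<le> D" "S \<le> D" using S0 by auto
  qed
  define Y where "Y = T * D ^ K / c"
  have Y0: "0 < Y" using T1 D1 c by (simp add: Y_def)
  have lnz: "0 < ln (cmod z)" using z(1) by (rule ln_gt_zero)
  have ln\<theta>: "0 < ln \<theta>" using \<theta> by simp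
  define C where "C = nat \<lceil>real d + (\<bar>ln Y\<bar> + real K * ln \<theta>) / ln (cmod z)\<rceil>"
  have Cge: "real d + (\<bar>ln Y\<bar> + real K * ln \<theta>) / ln (cmod z) \<le> real C"
    unfolding C_def by linarith
  have "n \<le> C * (A + 1)"
    if x0: "1 \<le> \<bar>x0\<bar>" "\<bar>x0\<bar> \<le> \<theta>"
      and bad: "\<forall>k\<in>{A..A+n}. \<bar>x0 * \<theta> ^ k - of_int (round (x0 * \<theta> ^ k))\<bar> < \<epsilon>" for x0 A n
  proof (cases "n \<le> d")
    case True
    have "d \<le> C"
    proof -
      have "0 \<le> (\<bar>ln Y\<bar> + real K * ln \<theta>) / ln (cmod z)" using lnz ln\<theta> by simp
      then show ?thesis using Cge by linarith
    qed
    then have "n \<le> C * 1" using True by simp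
    also have "\<dots> \<le> C * (A + 1)" by (intro mult_left_mono) auto
    finally show ?thesis .
  next
    case False
    then have nd: "d < n" by simp
    define x where "x = (\<lambda>k. x0 * \<theta> ^ k)"
    define N where "N = (\<lambda>k. round (x k))"
    have bad': "\<bar>x k - of_int (N k)\<bar> < \<epsilon>" if "A \<le> k" "k \<le> A + n" for k
      using bad that by (auto simp: x_def N_def)
    have xrec: "(\<Sum>j\<le>d. coeff P j * of_real (x (k + j))) = 0" for k
    proof -
      have "(\<Sum>j\<le>d. coeff P j * of_real (x (k + j))) = of_real (x0 * \<theta> ^ k) * poly P (of_real \<theta>)"
        by (simp add: poly_altdef x_def d_def sum_distrib_left power_add mult_ac)
      then show ?thesis using \<theta> by simp
    qed
    have Nrec: "(\<Sum>j\<le>d. coeff P j * of_int (N (k + j))) = 0" if "A \<le> k" "k + d \<le> A + n" for k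
    proof -
      let ?s = "\<Sum>j\<le>d. coeff P j * of_int (N (k + j))"
      have "?s \<in> \<int>" using int by (intro Ints_sum Ints_mult) auto
      then obtain b where b: "?s = of_int b" by (auto elim: Ints_cases)
      have "?s = (\<Sum>j\<le>d. coeff P j * of_real (of_int (N (k + j)) - x (k + j)))"
        using xrec[of k] by (simp add: sum_subtractf algebra_simps)
      also have "cmod \<dots> \<le> (\<Sum>j\<le>d. cmod (coeff P j) * \<epsilon>)"
      proof (rule sum_norm_le)
        fix j assume j: "j \<in> {..d}"
        have "\<bar>of_int (N (k + j)) - x (k + j)\<bar> \<le> \<epsilon>"
          using bad'[of "k + j"] j that by (simp add: abs_minus_commute)
        then show "cmod (coeff P j * of_real (of_int (N (k + j)) - x (k + j))) \<le> cmod (coeff P j) * \<epsilon>"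
          unfolding norm_mult norm_of_real by (intro mult_left_mono) auto
      qed
      also have "\<dots> = \<epsilon> * S" by (simp add: S_def sum_distrib_left mult.commute)
      also have "\<dots> < 1" by (rule \<epsilon>(3))
      finally have "cmod (of_int b) < 1" using b by simp
      then have "b = 0" by simp
      then show ?thesis using b by simp
    qed
    define \<Lambda> where "\<Lambda> = (\<lambda>k. \<Sum>j<d. t j * of_int (N (k + j)))"
    have step: "\<Lambda> (Suc k) = z * \<Lambda> k" if "A \<le> k" "k + d \<le> A + n" for k
      using shift_operator_telescope[OF z(3), of "\<lambda>j. of_int (N (k + j))"] Nrec[OF that]
      by (simp add: \<Lambda>_def t_def d_def)
    have pow: "\<Lambda> (A + i) = z ^ i * \<Lambda> A" if "i \<le> n - d" for i
      using that
    proof (induction i)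
      case (Suc i)
      then have "\<Lambda> (Suc (A + i)) = z * \<Lambda> (A + i)" by (intro step) auto
      then show ?case using Suc by simp
    qed simp
    \<comment> \<open>the progression is an eigenvector of the shift for \<open>\<theta>\<close>, a root of \<open>P / (X - z)\<close>\<close>
    have \<theta>kill: "(\<Sum>j<d. t j * of_real (x (k + j))) = 0" for k
    proof -
      have "(\<Sum>j<d. t j * of_real (x (k + Suc j))) = of_real \<theta> * (\<Sum>j<d. t j * of_real (x (k + j)))"
        by (simp add: x_def sum_distrib_left mult_ac)
      then have "(of_real \<theta> - z) * (\<Sum>j<d. t j * of_real (x (k + j))) = 0"
        using shift_operator_telescope[OF z(3), of "\<lambda>j. of_real (x (k + j))"] xrec[of k]
        by (simp add: t_def d_def left_diff_distrib)
      then show ?thesis using z(2) by auto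
    qed
    have bnd: "cmod (\<Lambda> k) \<le> T" if "A \<le> k" "k + d \<le> A + n" for k
    proof -
      have "\<Lambda> k = (\<Sum>j<d. t j * of_real (of_int (N (k + j)) - x (k + j)))"
        using \<theta>kill[of k] by (simp add: \<Lambda>_def sum_subtractf algebra_simps)
      also have "cmod \<dots> \<le> (\<Sum>j<d. cmod (t j) * 1)"
      proof (rule sum_norm_le)
        fix j assume j: "j \<in> {..<d}"
        have "\<bar>of_int (N (k + j)) - x (k + j)\<bar> \<le> 1"
          using bad'[of "k + j"] j that \<epsilon> by (simp add: abs_minus_commute)
        then show "cmod (t j * of_real (of_int (N (k + j)) - x (k + j))) \<le> cmod (t j) * 1"
          unfolding norm_mult norm_of_real by (intro mult_left_mono) auto
      qed
      also have "\<dots> \<le> T" by (simp add: T_def)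
      finally show ?thesis .
    qed
    define R where "R = (\<Sum>j<d. smult (of_int (N (A + j))) (poly_shift (Suc j) P))"
    have Rz: "poly R z = \<Lambda> A" by (simp add: R_def \<Lambda>_def t_def poly_sum mult.commute)
    have coeffR: "coeff R i = (\<Sum>j<d. of_int (N (A + j)) * coeff P (i + Suc j))" for i
      by (simp add: R_def coeff_sum coeff_poly_shift)
    have intR: "coeff R i \<in> \<int>" for i
      unfolding coeffR using int by (intro Ints_sum Ints_mult) auto
    have NA: "N A \<noteq> 0"
    proof -
      have "1 \<le> \<bar>x A\<bar>" unfolding x_def abs_mult power_abs
        using mult_mono[of 1 "\<bar>x0\<bar>" 1 "\<bar>\<theta>\<bar> ^ A"] x0 \<theta> by simp
      then show ?thesis using bad'[of A] \<epsilon> by auto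
    qed
    \<comment> \<open>its top coefficient is the leading coefficient of \<open>P\<close> times the nonzero integer \<open>N A\<close>\<close>
    have R0: "R \<noteq> 0"
    proof -
      have "coeff R (d - 1) = (\<Sum>j<d. if j = 0 then of_int (N A) * lead_coeff P else 0)"
        unfolding coeffR using d1 by (intro sum.cong) (auto simp: d_def coeff_eq_0)
      also have "\<dots> = of_int (N A) * lead_coeff P" using d1 by simp
      finally have "coeff R (d - 1) \<noteq> 0" using NA P0 by simp
      then show ?thesis by auto
    qed
    have degR: "degree R < d"
    proof -
      have "coeff R i = 0" if "d \<le> i" for i
        unfolding coeffR using that by (intro sum.neutral) (auto simp: d_def coeff_eq_0)
      then show ?thesis using R0 by (metis leading_coeff_0_iff not_le)
    qed
    define H where "H = D * \<theta> ^ A"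
    have \<theta>A: "1 \<le> \<theta> ^ A" using \<theta> by simp
    have DH: "D \<le> H" using D1 \<theta>A mult_left_mono[of 1 "\<theta> ^ A" D] by (simp add: H_def)
    have hR: "cmod (coeff R i) \<le> H" for i
    proof -
      have "cmod (coeff R i) \<le> (\<Sum>j<d. \<theta> ^ A * (\<theta> ^ (d + 1) + 1) * (S + 1))"
        unfolding coeffR
      proof (rule sum_norm_le)
        fix j assume j: "j \<in> {..<d}"
        have "\<bar>of_int (N (A + j))\<bar> \<le> \<bar>x (A + j)\<bar> + 1"
          using bad'[of "A + j"] j nd \<epsilon> by auto
        also have "\<bar>x (A + j)\<bar> \<le> \<theta> * \<theta> ^ (A + j)"
          unfolding x_def abs_mult power_abs using x0 \<theta> by (intro mult_mono) auto
        also have "\<theta> * \<theta> ^ (A + j) \<le> \<theta> ^ A * \<theta> ^ (d + 1)"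
          unfolding power_Suc[symmetric] power_add[symmetric] using j \<theta>
          by (intro power_increasing) auto
        also have "\<theta> ^ A * \<theta> ^ (d + 1) + 1 \<le> \<theta> ^ A * (\<theta> ^ (d + 1) + 1)"
          using \<theta>A by (simp add: algebra_simps)
        finally have 1: "\<bar>of_int (N (A + j))\<bar> \<le> \<theta> ^ A * (\<theta> ^ (d + 1) + 1)" by simp
        show "cmod (of_int (N (A + j)) * coeff P (i + Suc j)) \<le> \<theta> ^ A * (\<theta> ^ (d + 1) + 1) * (S + 1)"
          unfolding norm_mult using 1 coeff_le_S[of "i + Suc j"] \<theta>
          by (intro mult_mono) auto
      qed
      also have "\<dots> = real d * (\<theta> ^ A * (\<theta> ^ (d + 1) + 1) * (S + 1))" by simp
      also have "\<dots> \<le> real (d + 1) * (\<theta> ^ A * (\<theta> ^ (d + 1) + 1) * (S + 1))"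
        using \<theta> S0 by (intro mult_right_mono) auto
      also have "\<dots> = H" by (simp add: H_def D_def mult_ac)
      finally show ?thesis .
    qed
    have "c / H ^ K \<le> max (cmod (poly P z)) (cmod (poly R z))"
    proof (rule low)
      show "\<forall>w. \<not> (poly P w = 0 \<and> poly R w = 0)"
        using irr[OF intR R0] degR by (auto simp: d_def)
      show "\<forall>i. cmod (coeff P i) \<le> H \<and> cmod (coeff R i) \<le> H"
        using hR coeff_le_S D1 DH by (meson order_trans)
    qed (use degR int intR D1 DH in \<open>auto simp: d_def\<close>)
    then have lowA: "c / H ^ K \<le> cmod (\<Lambda> A)" using z Rz by simp
    have H0: "0 < H ^ K" using D1 DH by simp
    have "cmod z ^ (n - d) * (c / H ^ K) \<le> cmod z ^ (n - d) * cmod (\<Lambda> A)"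
      using lowA by (intro mult_left_mono) auto
    also have "\<dots> = cmod (\<Lambda> (A + (n - d)))" by (simp add: pow norm_mult norm_power)
    also have "\<dots> \<le> T" using nd by (intro bnd) auto
    finally have "cmod z ^ (n - d) \<le> T * H ^ K / c"
      using c H0 by (simp add: field_simps)
    also have "\<dots> = Y * \<theta> ^ (A * K)"
      by (simp add: Y_def H_def power_mult_distrib power_mult)
    finally have "ln (cmod z ^ (n - d)) \<le> ln (Y * \<theta> ^ (A * K))"
      using z(1) by (intro ln_mono) (auto intro!: zero_less_power)
    then have "real (n - d) * ln (cmod z) \<le> ln Y + real (A * K) * ln \<theta>"
      using Y0 \<theta> z by (simp add: ln_mult ln_realpow)
    also have "\<dots> \<le> (\<bar>ln Y\<bar> + real K * ln \<theta>) * real (A + 1)"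
    proof -
      have "0 \<le> real A * \<bar>ln Y\<bar>" "0 \<le> real K * ln \<theta>" using ln\<theta> by auto
      moreover have "(\<bar>ln Y\<bar> + real K * ln \<theta>) * real (A + 1)
          = \<bar>ln Y\<bar> + real A * \<bar>ln Y\<bar> + real K * ln \<theta> + real (A * K) * ln \<theta>"
        by (simp add: algebra_simps)
      ultimately show ?thesis using abs_ge_self[of "ln Y"] by linarith
    qed
    finally have "real (n - d) \<le> (\<bar>ln Y\<bar> + real K * ln \<theta>) / ln (cmod z) * real (A + 1)"
      using lnz by (simp add: pos_le_divide_eq)
    then have "real n \<le> real d * 1 + (\<bar>ln Y\<bar> + real K * ln \<theta>) / ln (cmod z) * real (A + 1)"
      using nd by simp
    also have "\<dots> \<le> real d * real (A + 1) + (\<bar>ln Y\<bar> + real K * ln \<theta>) / ln (cmod z) * real (A + 1)"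
      by (intro add_right_mono mult_left_mono) auto
    also have "\<dots> \<le> real C * real (A + 1)"
      unfolding distrib_right[symmetric] using Cge by (intro mult_right_mono) auto
    finally show ?thesis by (metis of_nat_mult of_nat_le_iff)
  qed
  then show ?thesis using \<epsilon>(1) by blast
qed

section \<open>Gains in renewal inequalities\<close>

text \<open>The differences of elements of \<open>S\<close> form a group that contains \<open>X\<close>, hence 1. So \<open>S\<close> contains two
consecutive numbers \<open>b\<close> and \<open>b + 1\<close>, and these generate everything from \<open>b * b\<close> on.\<close>

lemma additive_set_Gcd_1_cofinite:
  fixes S :: "nat set"
  assumes zero: "0 \<in> S" and add: "\<And>a b. a \<in> S \<Longrightarrow> b \<in> S \<Longrightarrow> a + b \<in> S"
    and sub: "X \<subseteq> S" and fin: "finite X" and Gcd: "Gcd X = 1"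
  shows "\<exists>T. \<forall>n\<ge>T. n \<in> S"
proof -
  define D where "D = {int a - int b | a b. a \<in> S \<and> b \<in> S}"
  have D0: "0 \<in> D" using zero by (force simp: D_def)
  have Dadd: "x + y \<in> D" if "x \<in> D" "y \<in> D" for x y
  proof -
    obtain a b a' b' where "x = int a - int b" "y = int a' - int b'" "a \<in> S" "b \<in> S" "a' \<in> S" "b' \<in> S"
      using \<open>x \<in> D\<close> \<open>y \<in> D\<close> by (auto simp: D_def)
    then have "x + y = int (a + a') - int (b + b')" "a + a' \<in> S" "b + b' \<in> S" by (auto intro: add)
    then show ?thesis unfolding D_def by blast
  qed
  have Dneg: "- x \<in> D" if "x \<in> D" for x using that by (force simp: D_def)
  have Dnat: "int n * x \<in> D" if "x \<in> D" for n x
    by (induction n) (auto simp: D0 algebra_simps intro: Dadd that)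
  have Dmult: "u * x \<in> D" if "x \<in> D" for u x
  proof (cases "0 \<le> u")
    case True
    then show ?thesis using Dnat[OF that, of "nat u"] by simp
  next
    case False
    then show ?thesis using Dneg[OF Dnat[OF that, of "nat (- u)"]] by simp
  qed
  have "int (Gcd X) \<in> D" using fin sub
  proof (induction X rule: finite_induct)
    case empty
    then show ?case using D0 by simp
  next
    case (insert x F)
    obtain u v where uv: "u * int x + v * int (Gcd F) = gcd (int x) (int (Gcd F))"
      using bezout_int by blast
    have "int x \<in> D" using insert.prems zero unfolding D_def by (intro CollectI exI[of _ x] exI[of _ 0]) auto
    then have "u * int x + v * int (Gcd F) \<in> D"
      using insert by (intro Dadd Dmult) auto
    then show ?case using uv by (simp only: Gcd_insert gcd_int_int_eq)
  qed
  then have "1 \<in> D" using Gcd by simp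
  then obtain a b where ab: "int a - int b = 1" "a \<in> S" "b \<in> S" by (auto simp: D_def)
  then have a: "a = b + 1" by simp
  have mult: "n * x \<in> S" if "x \<in> S" for n x
    by (induction n) (auto intro: zero add that)
  \<comment> \<open>with \<open>q\<close> and \<open>r\<close> the quotient and remainder of \<open>n\<close> by \<open>b\<close>: \<open>n = r (b + 1) + (q - r) b\<close>\<close>
  have "n \<in> S" if n: "b * b \<le> n" for n
  proof (cases "b = 0")
    case True
    then show ?thesis using mult[of a n] ab a by simp
  next
    case False
    have "n mod b < b" using False by simp
    also have "b \<le> n div b" using div_le_mono[OF n, of b] False by simp
    finally have le: "n mod b \<le> n div b" by simp
    have "n = (n mod b) * (b + 1) + (n div b - n mod b) * b"
      using le by (simp add: algebra_simps diff_mult_distrib2)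
    then show ?thesis using add[OF mult[of a "n mod b"] mult[of b "n div b - n mod b"]] ab a by metis
  qed
  then show ?thesis by blast
qed

lemma averaged_bound:
  fixes p :: "'i \<Rightarrow> real"
  assumes p: "\<And>i. i \<in> I \<Longrightarrow> 0 \<le> p i" "sum p I = 1"
    and g: "\<And>i. i \<in> I \<Longrightarrow> g i \<le> M"
  shows "(\<Sum>i\<in>I. p i * g i) \<le> M"
proof -
  have "(\<Sum>i\<in>I. p i * g i) \<le> (\<Sum>i\<in>I. p i * M)"
    using p g by (intro sum_mono mult_left_mono) auto
  also have "\<dots> = M" using p by (simp add: sum_distrib_right[symmetric])
  finally show ?thesis .
qed

lemma averaged_bound_gain:
  fixes p :: "'i \<Rightarrow> real"
  assumes fin: "finite I" and p: "\<And>i. i \<in> I \<Longrightarrow> 0 \<le> p i" "sum p I = 1"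
    and g: "\<And>i. i \<in> I \<Longrightarrow> g i \<le> M" and j: "j \<in> I" "g j \<le> (1 - c) * M"
  shows "(\<Sum>i\<in>I. p i * g i) \<le> (1 - p j * c) * M"
proof -
  have "(\<Sum>i\<in>I. p i * g i) = p j * g j + (\<Sum>i\<in>I - {j}. p i * g i)"
    using fin j by (simp add: sum.remove)
  also have "\<dots> \<le> p j * ((1 - c) * M) + (\<Sum>i\<in>I - {j}. p i * M)"
    using p g j by (intro add_mono sum_mono mult_left_mono) auto
  also have "(\<Sum>i\<in>I - {j}. p i * M) = (1 - p j) * M"
    using fin j p(2) by (simp add: sum_distrib_right[symmetric] sum_diff1)
  finally show ?thesis by (simp add: algebra_simps)
qed

text \<open>The shifts \<open>j\<close> by which a gain at \<open>s\<close> propagates to \<open>s + j\<close> with a positive part of it kept, uniformly in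
\<open>G\<close>, \<open>M\<close> and \<open>s\<close>, form an additive set that contains every \<open>l i\<close>, hence all large numbers. A window of
\<open>L + 1\<close> consecutive shifts with a common gain suffices: beyond it the renewal inequality averages only over
scales that already have the gain.\<close>

lemma renewal_gain_propagates:
  fixes p :: "'i \<Rightarrow> real" and l :: "'i \<Rightarrow> nat"
  assumes fin: "finite I" and p: "\<And>i. i \<in> I \<Longrightarrow> 0 < p i" "sum p I = 1"
    and l: "\<And>i. i \<in> I \<Longrightarrow> 0 < l i" "\<And>i. i \<in> I \<Longrightarrow> l i \<le> L" and Gcd: "Gcd (l ` I) = 1"
    and c: "0 < c" "c \<le> 1"
  obtains c' T where "0 < c'" "c' \<le> 1"
    "\<And>(G :: nat \<Rightarrow> real) M s k. \<lbrakk>L \<le> s; 0 \<le> M; \<And>k. s \<le> k \<Longrightarrow> G k \<le> (\<Sum>i\<in>I. p i * G (k - l i));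
       \<And>k. s \<le> k + L \<Longrightarrow> G k \<le> M; G s \<le> (1 - c) * M; s + T \<le> k\<rbrakk> \<Longrightarrow> G k \<le> (1 - c') * M"
proof -
  define adm where "adm = (\<lambda>(G :: nat \<Rightarrow> real) M s. L \<le> s \<and> 0 \<le> M \<and>
     (\<forall>k\<ge>s. G k \<le> (\<Sum>i\<in>I. p i * G (k - l i))) \<and> (\<forall>k. s \<le> k + L \<longrightarrow> G k \<le> M))"
  have adm_shift: "adm G M (s + j)" if "adm G M s" for G M s j
    using that by (auto simp: adm_def)
  define S where "S = {j. \<forall>c. 0 < c \<and> c \<le> 1 \<longrightarrow> (\<exists>c'. 0 < c' \<and> c' \<le> 1 \<and>
     (\<forall>G M s. adm G M s \<longrightarrow> G s \<le> (1 - c) * M \<longrightarrow> G (s + j) \<le> (1 - c') * M))}"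
  have 0: "0 \<in> S" by (auto simp: S_def)
  have add: "a + b \<in> S" if "a \<in> S" "b \<in> S" for a b
    unfolding S_def
  proof (intro CollectI allI impI)
    fix c :: real assume c: "0 < c \<and> c \<le> 1"
    obtain c1 where c1: "0 < c1 \<and> c1 \<le> 1"
      "\<And>G M s. adm G M s \<Longrightarrow> G s \<le> (1 - c) * M \<Longrightarrow> G (s + a) \<le> (1 - c1) * M"
      using \<open>a \<in> S\<close> c unfolding S_def by blast
    obtain c2 where c2: "0 < c2 \<and> c2 \<le> 1"
      "\<And>G M s. adm G M s \<Longrightarrow> G s \<le> (1 - c1) * M \<Longrightarrow> G (s + b) \<le> (1 - c2) * M"
      using \<open>b \<in> S\<close> c1(1) unfolding S_def by blast
    have "G (s + (a + b)) \<le> (1 - c2) * M" if "adm G M s" "G s \<le> (1 - c) * M" for G M s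
      using c2(2)[OF adm_shift[OF that(1)] c1(2)[OF that]] by (simp add: add.assoc)
    then show "\<exists>c'. 0 < c' \<and> c' \<le> 1 \<and>
     (\<forall>G M s. adm G M s \<longrightarrow> G s \<le> (1 - c) * M \<longrightarrow> G (s + (a + b)) \<le> (1 - c') * M)"
      using c2(1) by blast
  qed
  have gen: "l i \<in> S" if i: "i \<in> I" for i
    unfolding S_def
  proof (intro CollectI allI impI)
    fix c :: real assume c: "0 < c \<and> c \<le> 1"
    have pi1: "p i \<le> 1" using member_le_sum[OF i, of p] fin p by (simp add: less_imp_le)
    have "G (s + l i) \<le> (1 - p i * c) * M" if adm: "adm G M s" and G: "G s \<le> (1 - c) * M" for G M s
    proof -
      have "G (s + l i) \<le> (\<Sum>j\<in>I. p j * G (s + l i - l j))"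
        using adm by (auto simp: adm_def)
      also have "\<dots> \<le> (1 - p i * c) * M"
      proof (rule averaged_bound_gain[OF fin _ p(2) _ i])
        fix j assume j: "j \<in> I"
        have "s \<le> s + l i - l j + L" using l(2)[OF j] by simp
        then show "G (s + l i - l j) \<le> M" using adm unfolding adm_def by blast
      qed (use p G in \<open>auto simp: less_imp_le\<close>)
      finally show ?thesis .
    qed
    moreover have "0 < p i * c" "p i * c \<le> 1" using c p(1)[OF i] pi1 mult_mono[of "p i" 1 c 1] by auto
    ultimately show "\<exists>c'. 0 < c' \<and> c' \<le> 1 \<and>
     (\<forall>G M s. adm G M s \<longrightarrow> G s \<le> (1 - c) * M \<longrightarrow> G (s + l i) \<le> (1 - c') * M)" by blast
  qed
  obtain T where T: "\<And>n. T \<le> n \<Longrightarrow> n \<in> S"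
    using additive_set_Gcd_1_cofinite[OF 0 add _ _ Gcd] gen fin by blast
  have "\<forall>j\<in>{T..T + L}. \<exists>c'. 0 < c' \<and> c' \<le> 1 \<and>
     (\<forall>G M s. adm G M s \<longrightarrow> G s \<le> (1 - c) * M \<longrightarrow> G (s + j) \<le> (1 - c') * M)"
    using T c by (auto simp: S_def)
  then obtain e where e: "\<And>j. j \<in> {T..T+L} \<Longrightarrow> 0 < e j \<and> e j \<le> 1"
    "\<And>j G M s. j \<in> {T..T+L} \<Longrightarrow> adm G M s \<Longrightarrow> G s \<le> (1 - c) * M \<Longrightarrow> G (s + j) \<le> (1 - e j) * M"
    by metis
  define c' where "c' = Min (e ` {T..T+L})"
  have c'le: "c' \<le> e j" if "j \<in> {T..T+L}" for j using that by (simp add: c'_def)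
  have "c' \<in> e ` {T..T+L}" unfolding c'_def by (intro Min_in) auto
  then have c': "0 < c'" "c' \<le> 1" using e(1) by auto
  have final: "G k \<le> (1 - c') * M"
    if adm: "adm G M s" and G: "G s \<le> (1 - c) * M" and k: "s + T \<le> k" for G M s k
    using k
  proof (induction k rule: less_induct)
    case (less k)
    show ?case
    proof (cases "k \<le> s + T + L")
      case True
      define j where "j = k - s"
      have j: "j \<in> {T..T+L}" "k = s + j" using True less.prems by (auto simp: j_def)
      have "G k \<le> (1 - e j) * M" using e(2)[OF j(1) adm G] j(2) by simp
      also have "\<dots> \<le> (1 - c') * M"
        using c'le[OF j(1)] adm by (intro mult_right_mono) (auto simp: adm_def)
      finally show ?thesis .
    next
      case False
      have "G k \<le> (\<Sum>i\<in>I. p i * G (k - l i))" using adm less.prems by (auto simp: adm_def)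
      also have "\<dots> \<le> (1 - c') * M"
      proof (rule averaged_bound[OF _ p(2)])
        fix i assume i: "i \<in> I"
        show "G (k - l i) \<le> (1 - c') * M"
          using l(1)[OF i] l(2)[OF i] False by (intro less.IH) auto
      qed (use p in \<open>auto simp: less_imp_le\<close>)
      finally show ?thesis .
    qed
  qed
  show thesis
  proof (rule that[OF c'])
    fix G :: "nat \<Rightarrow> real" and M s k
    assume "L \<le> s" "0 \<le> M" "\<And>k. s \<le> k \<Longrightarrow> G k \<le> (\<Sum>i\<in>I. p i * G (k - l i))"
      "\<And>k. s \<le> k + L \<Longrightarrow> G k \<le> M" "G s \<le> (1 - c) * M" "s + T \<le> k"
    then show "G k \<le> (1 - c') * M" by (intro final) (auto simp: adm_def)
  qed
qed

text \<open>Iterating the step \<open>A \<mapsto> D * (A + 1)\<close> from 0 stays below \<open>(2 * D) ^ i\<close> after \<open>i\<close> steps, when the bound has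
become \<open>\<rho> ^ i\<close>. Taking \<open>i\<close> about \<open>log k\<close> in base \<open>2 * D\<close> gives a power of \<open>k\<close>.\<close>

lemma geometric_scale_decay:
  fixes G :: "nat \<Rightarrow> real" and D :: nat
  assumes D: "1 \<le> D" and \<rho>: "0 < \<rho>" "\<rho> < 1" and G1: "\<And>k. G k \<le> 1"
    and step: "\<And>A M. 0 \<le> M \<Longrightarrow> (\<forall>k\<ge>A. G k \<le> M) \<Longrightarrow> (\<forall>k\<ge>D * (A + 1). G k \<le> \<rho> * M)"
    and k: "1 \<le> k"
  shows "G k \<le> (1 / \<rho>) * real k powr (ln \<rho> / ln (2 * real D))"
proof -
  define E where "E = 2 * real D"
  have E: "2 \<le> E" using D by (simp add: E_def)
  have scale: "\<exists>A. A + 1 \<le> (2 * D) ^ i \<and> (\<forall>k\<ge>A. G k \<le> \<rho> ^ i)" for i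
  proof (induction i)
    case 0
    then show ?case using G1 by (intro exI[of _ 0]) auto
  next
    case (Suc i)
    then obtain A where A: "A + 1 \<le> (2 * D) ^ i" "\<forall>k\<ge>A. G k \<le> \<rho> ^ i" by blast
    have "D * (A + 1) + 1 \<le> 2 * D * (A + 1)" using D by (simp add: Suc_le_eq)
    also have "\<dots> \<le> 2 * D * (2 * D) ^ i" using A by (intro mult_left_mono) auto
    finally show ?case using step[OF _ A(2)] \<rho> by (intro exI[of _ "D * (A + 1)"]) auto
  qed
  define i where "i = nat \<lfloor>log E (real k)\<rfloor>"
  have lg: "0 \<le> log E (real k)" using k E by simp
  then have i1: "real i \<le> log E (real k)" "log E (real k) < real i + 1"
    by (auto simp: i_def)
  have "real ((2 * D) ^ i) = E powr real i" using E by (simp add: E_def powr_realpow)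
  also have "\<dots> \<le> E powr log E (real k)" using i1 E by (intro powr_mono) auto
  also have "\<dots> = real k" using k E by simp
  finally have "(2 * D) ^ i \<le> k" by linarith
  then have "G k \<le> \<rho> ^ i" using scale[of i] by auto
  also have "\<rho> ^ i = \<rho> powr real i" using \<rho> by (simp add: powr_realpow)
  also have "\<dots> \<le> \<rho> powr (log E (real k) - 1)" using i1 \<rho> by (intro powr_mono') auto
  also have "\<dots> = (1 / \<rho>) * \<rho> powr (log E (real k))" using \<rho> by (simp add: powr_diff)
  also have "\<rho> powr (log E (real k)) = real k powr (ln \<rho> / ln E)"
    using \<rho> k by (simp add: powr_def log_def)
  finally show ?thesis by (simp add: E_def)
qed

section \<open>The Fourier transform of a self-similar measure\<close>

text \<open>The identity for measures of sets says that \<open>M\<close> is a mixture, that is, the monadic bind of the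
discrete distribution \<open>p\<close> with the image measures; integrals against a bind are iterated integrals.\<close>

lemma mixture_integral_real:
  fixes h :: "real \<Rightarrow> real" and f :: "'i \<Rightarrow> real \<Rightarrow> real" and p :: "'i \<Rightarrow> real"
  assumes fin: "finite I" and p: "\<And>i. i \<in> I \<Longrightarrow> 0 < p i" "sum p I = 1"
    and M: "prob_space M" and sets_M: "sets M = sets borel"
    and f[measurable]: "\<And>i. f i \<in> borel_measurable borel"
    and mix: "\<And>A. A \<in> sets borel \<Longrightarrow> measure M A = (\<Sum>i\<in>I. p i * measure (distr M borel (f i)) A)"
    and h[measurable]: "h \<in> borel_measurable borel" and B: "\<And>x. \<bar>h x\<bar> \<le> B"
  shows "(\<integral>x. h x \<partial>M) = (\<Sum>i\<in>I. p i * (\<integral>x. h (f i x) \<partial>M))"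
proof -
  interpret prob_space M by (rule M)
  note [measurable_cong] = sets_M
  define q where "q = (\<lambda>i. if i \<in> I then p i else 0)"
  have q0: "\<And>i. 0 \<le> q i" using p by (auto simp: q_def less_imp_le)
  have q1: "(\<integral>\<^sup>+ i. ennreal (q i) \<partial>count_space UNIV) = 1"
  proof -
    have "(\<integral>\<^sup>+ i. ennreal (q i) \<partial>count_space UNIV) = (\<Sum>i\<in>I. ennreal (q i))"
      using fin by (intro nn_integral_count_space'[of I]) (auto simp: q_def)
    also have "\<dots> = ennreal (\<Sum>i\<in>I. q i)" using q0 by (intro sum_ennreal) auto
    also have "(\<Sum>i\<in>I. q i) = 1" using p(2) by (simp add: q_def)
    finally show ?thesis by simp
  qed
  define P where "P = embed_pmf q"
  have pmf_P: "pmf P i = q i" for i unfolding P_def by (rule pmf_embed_pmf[OF q0 q1])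
  have set_P: "set_pmf P \<subseteq> I" by (auto simp: set_pmf_iff pmf_P q_def split: if_splits)
  define N where "N = (\<lambda>i. distr M borel (f i))"
  have pN: "prob_space (N i)" for i unfolding N_def by (intro prob_space_distr) measurable
  have N: "N \<in> measurable (measure_pmf P) (subprob_algebra borel)"
    using pN by (auto simp: space_subprob_algebra N_def intro: prob_space_imp_subprob_space)
  have MN: "M = measure_pmf P \<bind> N"
  proof (rule measure_eqI)
    show "sets M = sets (measure_pmf P \<bind> N)"
      using sets_bind[OF _ , of "measure_pmf P" N borel] by (simp add: sets_M N_def)
    fix A assume "A \<in> sets M"
    then have A: "A \<in> sets borel" by (simp add: sets_M)
    have "emeasure (measure_pmf P \<bind> N) A = (\<integral>\<^sup>+ i. emeasure (N i) A \<partial>measure_pmf P)"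
      by (rule emeasure_bind[OF _ N A]) simp
    also have "\<dots> = (\<Sum>i\<in>I. emeasure (N i) A * pmf P i)"
      using set_P fin by (intro nn_integral_measure_pmf_support) auto
    also have "\<dots> = (\<Sum>i\<in>I. ennreal (p i * measure (N i) A))"
      using p by (intro sum.cong)
        (auto simp: pmf_P q_def finite_measure.emeasure_eq_measure[OF prob_space.finite_measure[OF pN]]
              ennreal_mult'' mult.commute less_imp_le)
    also have "\<dots> = ennreal (\<Sum>i\<in>I. p i * measure (N i) A)"
      using p by (intro sum_ennreal) (auto simp: less_imp_le)
    also have "\<dots> = emeasure M A" using mix[OF A] by (simp add: N_def emeasure_eq_measure)
    finally show "emeasure M A = emeasure (measure_pmf P \<bind> N) A" ..
  qed
  have "(\<integral>x. h x \<partial>M) = (\<integral>i. (\<integral>x. h x \<partial>N i) \<partial>measure_pmf P)"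
    by (subst MN, rule integral_bind[OF h B N, of 1])
       (auto simp: prob_space.emeasure_space_1[OF pN])
  also have "\<dots> = (\<Sum>i\<in>I. (\<integral>x. h x \<partial>N i) * pmf P i)"
    using set_P fin by (intro integral_measure_pmf_real) auto
  also have "\<dots> = (\<Sum>i\<in>I. p i * (\<integral>x. h (f i x) \<partial>M))"
    by (intro sum.cong) (auto simp: pmf_P q_def N_def integral_distr)
  finally show ?thesis .
qed

lemma fourier_transform_integrable:
  assumes "prob_space M" "sets M = sets borel"
  shows "integrable M (\<lambda>t. iexp (c * t))"
proof -
  interpret prob_space M by fact
  note [measurable_cong] = assms(2)
  show ?thesis by (rule integrable_const_bound[of _ 1]) auto
qed

lemma norm_fourier_transform_le_1:
  assumes "prob_space M" "sets M = sets borel"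
  shows "norm (fourier_transform M u) \<le> 1"
proof -
  interpret prob_space M by fact
  have "norm (fourier_transform M u) \<le> (\<integral>t. norm (iexp (2 * pi * u * t)) \<partial>M)"
    unfolding fourier_transform_def by (rule integral_norm_bound)
  then show ?thesis by (simp add: prob_space)
qed

lemma fourier_self_similar:
  fixes b :: "'i \<Rightarrow> real"
  assumes fin: "finite I" and p: "\<And>i. i \<in> I \<Longrightarrow> 0 < p i" "sum p I = 1"
    and ss: "is_self_similar_measure I (\<lambda>i x. b i * x + a i) p M"
  shows "fourier_transform M u = (\<Sum>i\<in>I. of_real (p i) * iexp (2 * pi * (a i * u)) * fourier_transform M (b i * u))"
proof -
  have M: "prob_space M" "sets M = sets borel" using ss by (auto simp: is_self_similar_measure_def)
  note int = fourier_transform_integrable[OF M]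
  define g where "g = (\<lambda>i t. iexp (2 * pi * u * (b i * t + a i)))"
  have g: "g i t = iexp (2 * pi * (a i * u)) * iexp (2 * pi * (b i * u) * t)" for i t
    unfolding g_def exp_add[symmetric] by (simp add: algebra_simps)
  have gi: "integrable M (g i)" for i
    unfolding g by (intro integrable_mult_right int)
  have gint: "(CLINT t|M. g i t) = iexp (2 * pi * (a i * u)) * fourier_transform M (b i * u)" for i
    unfolding g fourier_transform_def by simp
  have mix: "(\<integral>x. h x \<partial>M) = (\<Sum>i\<in>I. p i * (\<integral>x. h (b i * x + a i) \<partial>M))"
    if [measurable]: "h \<in> borel_measurable borel" and "\<And>x. \<bar>h x\<bar> \<le> 1" for h :: "real \<Rightarrow> real"
    using ss p that by (intro mixture_integral_real[OF fin _ _ M]) (auto simp: is_self_similar_measure_def)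
  have bd: "\<bar>Re (iexp x)\<bar> \<le> 1" "\<bar>Im (iexp x)\<bar> \<le> 1" for x
    using abs_Re_le_cmod[of "iexp x"] abs_Im_le_cmod[of "iexp x"] by auto
  have "fourier_transform M u = (\<Sum>i\<in>I. of_real (p i) * (CLINT t|M. g i t))"
  proof (rule complex_eqI)
    have "Re (fourier_transform M u) = (\<integral>t. Re (iexp (2 * pi * u * t)) \<partial>M)"
      unfolding fourier_transform_def by (rule integral_Re[symmetric, OF int])
    also have "\<dots> = (\<Sum>i\<in>I. p i * (\<integral>t. Re (g i t) \<partial>M))"
      unfolding g_def by (rule mix, measurable, rule bd)
    also have "\<dots> = Re (\<Sum>i\<in>I. of_real (p i) * (CLINT t|M. g i t))"
      by (simp add: integral_Re[OF gi])
    finally show "Re (fourier_transform M u) = Re (\<Sum>i\<in>I. of_real (p i) * (CLINT t|M. g i t))" .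
    have "Im (fourier_transform M u) = (\<integral>t. Im (iexp (2 * pi * u * t)) \<partial>M)"
      unfolding fourier_transform_def by (rule integral_Im[symmetric, OF int])
    also have "\<dots> = (\<Sum>i\<in>I. p i * (\<integral>t. Im (g i t) \<partial>M))"
      unfolding g_def by (rule mix, measurable, rule bd)
    also have "\<dots> = Im (\<Sum>i\<in>I. of_real (p i) * (CLINT t|M. g i t))"
      by (simp add: integral_Im[OF gi])
    finally show "Im (fourier_transform M u) = Im (\<Sum>i\<in>I. of_real (p i) * (CLINT t|M. g i t))" .
  qed
  then show ?thesis by (simp add: gint mult.assoc)
qed

text \<open>The condition says that the fixed points \<open>a i / (1 - b i)\<close> and \<open>a j / (1 - b j)\<close> differ. If all maps
had the same fixed point \<open>x\<close>, a point of \<open>K\<close> farthest from \<open>x\<close> would be the image of a point of \<open>K\<close> still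
farther away, unless \<open>K = {x}\<close>; then \<open>x\<close> would be an atom.\<close>

lemma non_atomic_distinct_fixed_points:
  fixes b :: "'i \<Rightarrow> real"
  assumes b: "\<And>i. i \<in> I \<Longrightarrow> 0 < b i \<and> b i < 1"
    and ss: "is_self_similar_measure I (\<lambda>i x. b i * x + a i) p M" and na: "non_atomic M"
  obtains i j where "i \<in> I" "j \<in> I" "a i * (1 - b j) \<noteq> a j * (1 - b i)"
proof (rule ccontr)
  assume "\<not> thesis"
  with that have "\<not> (\<exists>i\<in>I. \<exists>j\<in>I. a i * (1 - b j) \<noteq> a j * (1 - b i))" by blast
  then have eq: "a i * (1 - b j) = a j * (1 - b i)" if "i \<in> I" "j \<in> I" for i j
    using that by blast
  obtain K where K: "compact K" "K \<noteq> {}" "K = (\<Union>i\<in>I. (\<lambda>x. b i * x + a i) ` K)" "emeasure M (- K) = 0"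
    and M: "prob_space M" "sets M = sets borel"
    using ss by (auto simp: is_self_similar_measure_def is_self_similar_set_def)
  obtain i0 where i0: "i0 \<in> I" using K(2,3) by blast
  define x where "x = a i0 / (1 - b i0)"
  have a: "a i = x * (1 - b i)" if "i \<in> I" for i
    using eq[OF that i0] b[OF i0] by (simp add: x_def field_simps)
  have "continuous_on K (\<lambda>y. \<bar>y - x\<bar>)" by (intro continuous_intros)
  then obtain y where y: "y \<in> K" "\<And>w. w \<in> K \<Longrightarrow> \<bar>w - x\<bar> \<le> \<bar>y - x\<bar>"
    using continuous_attains_sup[OF K(1,2)] by blast
  obtain i y' where i: "i \<in> I" "y' \<in> K" "y = b i * y' + a i" using y(1) K(3) by blast
  have "y - x = b i * (y' - x)" using i a by (simp add: algebra_simps)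
  then have "\<bar>y - x\<bar> = b i * \<bar>y' - x\<bar>" using b[OF i(1)] by (simp add: abs_mult)
  also have "\<dots> \<le> b i * \<bar>y - x\<bar>" using y(2)[OF i(2)] b[OF i(1)] by (intro mult_left_mono) auto
  finally have "(1 - b i) * \<bar>y - x\<bar> \<le> 0" by (simp add: algebra_simps)
  then have "\<bar>y - x\<bar> \<le> 0" using b[OF i(1)] by (simp add: mult_le_0_iff)
  then have "K \<subseteq> {x}" using y(2) by fastforce
  interpret prob_space M by (rule M)
  have "K \<in> sets M" using K(1) M(2) by (simp add: compact_imp_closed)
  moreover have "space M = UNIV" using sets_eq_imp_space_eq[OF M(2)] by simp
  ultimately have "emeasure M K + emeasure M (- K) = 1"
    using emeasure_space_1 plus_emeasure[of K M "- K"] M(2) by (simp add: Compl_eq_Diff_UNIV sets.Diff)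
  moreover have "emeasure M K \<le> emeasure M {x}"
    using \<open>K \<subseteq> {x}\<close> M(2) by (intro emeasure_mono) auto
  ultimately show False using K(4) na by (auto simp: non_atomic_def)
qed

lemma phase_gap:
  assumes e: "0 < e" "e \<le> 1 / 2"
  obtains \<kappa> where "0 < \<kappa>" "\<kappa> \<le> 1" "\<And>y. e \<le> \<bar>y - of_int (round y)\<bar> \<Longrightarrow> norm (1 + iexp (2 * pi * y)) \<le> 2 - \<kappa>"
proof -
  define \<kappa> where "\<kappa> = min 1 (2 - sqrt (2 + 2 * cos (2 * pi * e)))"
  have "cos (2 * pi * e) < cos 0" using e by (intro cos_monotone_0_pi) auto
  then have "sqrt (2 + 2 * cos (2 * pi * e)) < sqrt 4" by (intro real_sqrt_less_mono) simp
  then have \<kappa>: "0 < \<kappa>" "\<kappa> \<le> 1" by (auto simp: \<kappa>_def)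
  have "norm (1 + iexp (2 * pi * y)) \<le> 2 - \<kappa>" if y: "e \<le> \<bar>y - of_int (round y)\<bar>" for y
  proof -
    define \<delta> where "\<delta> = \<bar>y - of_int (round y)\<bar>"
    have \<delta>: "e \<le> \<delta>" "\<delta> \<le> 1 / 2"
      using y of_int_round_abs_le[of y] by (auto simp: \<delta>_def abs_minus_commute)
    have "cos (2 * pi * y) = cos (2 * pi * (y - of_int (round y)) + 2 * pi * of_int (round y))"
      by (simp add: algebra_simps)
    also have "\<dots> = cos (2 * pi * (y - of_int (round y)))"
      by (simp add: cos_add)
    also have "\<dots> = cos (2 * pi * \<delta>)"
      using cos_abs_real[of "2 * pi * (y - of_int (round y))"] by (simp add: \<delta>_def abs_mult)
    also have "\<dots> \<le> cos (2 * pi * e)" using \<delta> e by (intro cos_monotone_0_pi_le) auto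
    finally have c: "cos (2 * pi * y) \<le> cos (2 * pi * e)" .
    have "norm (1 + iexp (2 * pi * y)) ^ 2 = (1 + cos (2 * pi * y))\<^sup>2 + (sin (2 * pi * y))\<^sup>2"
      by (simp add: cmod_power2 Re_exp Im_exp)
    also have "\<dots> = 2 + 2 * cos (2 * pi * y)"
      using sin_cos_squared_add[of "2 * pi * y"] by (simp add: power2_eq_square algebra_simps)
    finally have "norm (1 + iexp (2 * pi * y)) = sqrt (2 + 2 * cos (2 * pi * y))"
      by (metis norm_ge_zero real_sqrt_unique)
    also have "\<dots> \<le> sqrt (2 + 2 * cos (2 * pi * e))" using c by simp
    also have "\<dots> \<le> 2 - \<kappa>" by (simp add: \<kappa>_def)
    finally show ?thesis .
  qed
  with \<kappa> show thesis using that by blast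
qed

lemma norm_weighted_sum_le:
  fixes F :: "'i \<Rightarrow> complex"
  assumes "finite J" "\<And>k. k \<in> J \<Longrightarrow> 0 \<le> p k" "\<And>k. k \<in> J \<Longrightarrow> norm (F k) \<le> M"
  shows "norm (\<Sum>k\<in>J. of_real (p k) * iexp (s k) * F k) \<le> sum p J * M"
proof -
  have "norm (\<Sum>k\<in>J. of_real (p k) * iexp (s k) * F k) \<le> (\<Sum>k\<in>J. p k * M)"
    using assms by (intro sum_norm_le) (auto simp: norm_mult intro!: mult_left_mono)
  then show ?thesis by (simp add: sum_distrib_right)
qed

text \<open>Expand \<open>F v\<close> by self-similarity, and expand the terms of index \<open>i\<close> and \<open>j\<close> once more. The words \<open>i j\<close>
and \<open>j i\<close> both involve \<open>F (b i * b j * v)\<close> with weight \<open>p i * p j\<close>, and the sum of their two phases has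
the absolute value that \<open>gap\<close> bounds; in all other terms only \<open>F\<close> is estimated, by \<open>B\<close>.\<close>

lemma two_word_gain:
  fixes b :: "'i \<Rightarrow> real"
  assumes fin: "finite I" and p: "\<And>i. i \<in> I \<Longrightarrow> 0 < p i" "sum p I = 1"
    and ss: "is_self_similar_measure I (\<lambda>i x. b i * x + a i) p M"
    and ij: "i \<in> I" "j \<in> I" "i \<noteq> j"
    and gap: "norm (1 + iexp (2 * pi * ((a i * (1 - b j) - a j * (1 - b i)) * v))) \<le> 2 - \<kappa>" and \<kappa>: "\<kappa> \<le> 2"
    and B1: "\<And>k. k \<in> I \<Longrightarrow> norm (fourier_transform M (b k * v)) \<le> B"
    and B2: "\<And>k k'. k \<in> I \<Longrightarrow> k' \<in> I \<Longrightarrow> norm (fourier_transform M (b k * (b k' * v))) \<le> B"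
  shows "norm (fourier_transform M v) \<le> (1 - p i * p j * \<kappa>) * B"
proof -
  define F where "F = fourier_transform M"
  define E where "E = (\<lambda>x. iexp (2 * pi * x))"
  have eq: "F u = (\<Sum>k\<in>I. of_real (p k) * E (a k * u) * F (b k * u))" for u
    unfolding F_def E_def by (rule fourier_self_similar[OF fin p ss])
  have B0: "0 \<le> B" using B1[OF ij(1)] norm_ge_zero order_trans by blast
  define w where "w = b i * (b j * v)"
  define X where "X = (\<Sum>k\<in>I - {i} - {j}. of_real (p k) * E (a k * v) * F (b k * v))"
  define Y where "Y = (\<Sum>k\<in>I - {j}. of_real (p k) * E (a k * (b i * v)) * F (b k * (b i * v)))"
  define Z where "Z = (\<Sum>k\<in>I - {i}. of_real (p k) * E (a k * (b j * v)) * F (b k * (b j * v)))"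
  have Fi: "F (b i * v) = of_real (p j) * E (a j * (b i * v)) * F w + Y"
    unfolding Y_def using fin ij by (subst eq, subst sum.remove[of I j]) (auto simp: w_def mult_ac)
  have Fj: "F (b j * v) = of_real (p i) * E (a i * (b j * v)) * F w + Z"
    unfolding Z_def using fin ij by (subst eq, subst sum.remove[of I i]) (auto simp: w_def mult_ac)
  have Fv: "F v = of_real (p i) * E (a i * v) * F (b i * v) + (of_real (p j) * E (a j * v) * F (b j * v) + X)"
    unfolding X_def using fin ij by (subst eq, subst sum.remove[of I i], simp, simp, subst sum.remove[of "I - {i}" j]) auto
  define \<Phi> where "\<Phi> = E (a i * v) * E (a j * (b i * v)) + E (a j * v) * E (a i * (b j * v))"
  have split: "F v = of_real (p i * p j) * \<Phi> * F w + of_real (p i) * E (a i * v) * Y + of_real (p j) * E (a j * v) * Z + X"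
    unfolding Fv Fi Fj \<Phi>_def by (simp add: algebra_simps)
  have "\<Phi> = E (a j * v) * E (a i * (b j * v)) * (1 + E ((a i * (1 - b j) - a j * (1 - b i)) * v))"
    unfolding \<Phi>_def E_def distrib_left exp_add[symmetric] by (simp add: algebra_simps flip: exp_add)
  then have \<Phi>: "norm \<Phi> \<le> 2 - \<kappa>" using gap by (simp add: E_def norm_mult)
  have nX: "norm X \<le> sum p (I - {i} - {j}) * B"
    unfolding X_def E_def using fin p B1 by (intro norm_weighted_sum_le) (auto simp: F_def less_imp_le)
  have nY: "norm Y \<le> sum p (I - {j}) * B"
    unfolding Y_def E_def using fin p B2 ij by (intro norm_weighted_sum_le) (auto simp: F_def less_imp_le)
  have nZ: "norm Z \<le> sum p (I - {i}) * B"
    unfolding Z_def E_def using fin p B2 ij by (intro norm_weighted_sum_le) (auto simp: F_def less_imp_le)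
  have s: "sum p (I - {j}) = 1 - p j" "sum p (I - {i}) = 1 - p i" "sum p (I - {i} - {j}) = 1 - p i - p j"
    using fin ij p(2) by (auto simp: sum_diff1)
  have pp: "0 < p i" "0 < p j" using p ij by auto
  have nF: "norm (F w) \<le> B" using B2 ij by (auto simp: F_def w_def)
  have "norm (F v) \<le> norm (of_real (p i * p j) * \<Phi> * F w) + norm (of_real (p i) * E (a i * v) * Y)
      + norm (of_real (p j) * E (a j * v) * Z) + norm X"
    unfolding split by (intro norm_triangle_mono order_refl)
  also have "\<dots> = p i * p j * (norm \<Phi> * norm (F w)) + p i * norm Y + p j * norm Z + norm X"
    using pp by (simp add: norm_mult E_def)
  also have "\<dots> \<le> p i * p j * ((2 - \<kappa>) * B) + p i * ((1 - p j) * B) + p j * ((1 - p i) * B) + (1 - p i - p j) * B"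
    using pp \<Phi> nF nX nY nZ B0 \<kappa> unfolding s
    by (intro add_mono mult_left_mono mult_mono) auto
  also have "\<dots> = (1 - p i * p j * \<kappa>) * B" by (simp add: algebra_simps)
  finally show ?thesis by (simp add: F_def)
qed

section \<open>Logarithmic Fourier decay\<close>

lemma common_denominator:
  fixes q :: "rat poly"
  obtains N :: int where "N \<noteq> 0" "\<And>i. of_int N * coeff q i \<in> \<int>"
proof -
  have "\<exists>N::int. N \<noteq> 0 \<and> (\<forall>i. of_int N * coeff q i \<in> \<int>)"
  proof (induction q)
    case 0
    show ?case by (intro exI[of _ 1]) auto
  next
    case (pCons a q)
    then obtain N :: int where N: "N \<noteq> 0" "\<And>i. of_int N * coeff q i \<in> \<int>" by blast
    obtain s t where st: "quotient_of a = (s, t)" by (cases "quotient_of a")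
    then have t: "t > 0" "a = of_int s / of_int t"
      using quotient_of_denom_pos quotient_of_div by auto
    have "of_int (t * N) * coeff (pCons a q) i \<in> \<int>" for i
    proof (cases i)
      case 0
      have "of_int (t * N) * coeff (pCons a q) i = of_int (s * N)" using t 0 by simp
      then show ?thesis by (metis Ints_of_int)
    next
      case (Suc i')
      have "of_int (t * N) * coeff (pCons a q) i = of_int t * (of_int N * coeff q i')" using Suc by simp
      then show ?thesis using N(2)[of i'] by (metis Ints_mult Ints_of_int)
    qed
    then show ?case using t N by (intro exI[of _ "t * N"]) auto
  qed
  then show thesis using that by blast
qed

text \<open>The minimal polynomial with its denominators cleared, as a complex polynomial with integer
coefficients.\<close>

lemma conjugate_integer_polynomial:
  fixes x z :: complex
  assumes "z \<in> conjugates x"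
  obtains P :: "complex poly" where "P \<noteq> 0" "\<And>i. coeff P i \<in> \<int>" "poly P x = 0" "poly P z = 0"
    "\<And>R w. \<lbrakk>\<And>i. coeff R i \<in> \<int>; R \<noteq> 0; degree R < degree P; poly P w = 0\<rbrakk> \<Longrightarrow> poly R w \<noteq> 0"
proof -
  obtain q :: "rat poly" where q: "irreducible q" "poly (map_poly of_rat q) x = 0" "poly (map_poly of_rat q) z = 0"
    using assms by (auto simp: conjugates_def is_minimal_polynomial_def)
  obtain N :: int where N: "N \<noteq> 0" "\<And>i. of_int N * coeff q i \<in> \<int>" using common_denominator by blast
  define P where "P = smult (of_int N) (map_poly of_rat q :: complex poly)"
  have degP: "degree P = degree q" using N by (simp add: P_def degree_map_poly)
  have q0: "q \<noteq> 0" using q(1) by auto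
  have P0: "P \<noteq> 0" using N q0 by (simp add: P_def map_poly_eq_0_iff)
  have int: "coeff P i \<in> \<int>" for i
  proof -
    obtain k where "of_int N * coeff q i = of_int k" using N(2)[of i] by (auto elim: Ints_cases)
    then have "of_rat (of_int N * coeff q i) = (of_int k :: complex)" by simp
    then have "coeff P i = of_int k" by (simp add: P_def coeff_map_poly of_rat_mult)
    then show ?thesis by simp
  qed
  have irr: "poly R w \<noteq> 0"
    if R: "\<And>i. coeff R i \<in> \<int>" "R \<noteq> 0" "degree R < degree P" and w: "poly P w = 0" for R w
  proof -
    have "coeff R i \<in> \<rat>" for i using R(1)[of i] Ints_subset_Rats by blast
    then obtain R' :: "rat poly" where R': "R = map_poly of_rat R'" by (rule ratpolyE)
    have "R' \<noteq> 0" "degree R' < degree q" using R R' degP by (auto simp: degree_map_poly)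
    then show ?thesis
      using irreducible_no_common_root[OF q(1), of R' w] w N R' by (simp add: P_def)
  qed
  show thesis using that[OF P0 int _ _ irr] q by (simp add: P_def)
qed

text \<open>For every start \<open>A\<close> a good scale \<open>s\<close> exists between \<open>A + 2 * L\<close> and a constant times \<open>A + 1\<close>; the offset
\<open>2 * L\<close> keeps the scales reached by two letters above \<open>A\<close>. The gain at \<open>s\<close> spreads to all
\<open>k \<ge> s + T\<close>, which is the contraction step needed for power decay. The constants do not depend on \<open>w\<close>.\<close>

lemma decay_along_geometric_progressions:
  fixes r :: real and l :: "'i \<Rightarrow> nat" and a p :: "'i \<Rightarrow> real"
  assumes fin: "finite I" and r: "0 < r" "r < 1"
    and l: "\<And>i. i \<in> I \<Longrightarrow> l i > 0" and Gcd: "Gcd (l ` I) = 1"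
    and p: "\<And>i. i \<in> I \<Longrightarrow> 0 < p i" "(\<Sum>i\<in>I. p i) = 1"
    and ss: "is_self_similar_measure I (\<lambda>i x. r ^ l i * x + a i) p \<mu>"
    and ij: "i \<in> I" "j \<in> I" and \<alpha>: "\<alpha> = a i * (1 - r ^ l j) - a j * (1 - r ^ l i)" "\<alpha> \<noteq> 0"
    and conj: "z \<in> conjugates (complex_of_real (inverse r))" "z \<noteq> complex_of_real (inverse r)" "norm z > 1"
  shows "\<exists>\<gamma>>0. \<exists>B. \<forall>w k. 1 \<le> \<bar>\<alpha> * w\<bar> \<longrightarrow> \<bar>\<alpha> * w\<bar> \<le> inverse r \<longrightarrow> 1 \<le> k \<longrightarrow>
     norm (fourier_transform \<mu> (w * inverse r ^ k)) \<le> B * real k powr (- \<gamma>)"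
proof -
  define \<theta> where "\<theta> = inverse r"
  have \<theta>: "1 < \<theta>" using r by (simp add: \<theta>_def one_less_inverse)
  have \<mu>: "prob_space \<mu>" "sets \<mu> = sets borel" using ss by (auto simp: is_self_similar_measure_def)
  define F where "F = fourier_transform \<mu>"
  have neq: "i \<noteq> j" using \<alpha> by auto
  obtain P :: "complex poly" where P: "P \<noteq> 0" "\<And>i. coeff P i \<in> \<int>" "poly P (of_real \<theta>) = 0" "poly P z = 0"
    "\<And>R w. \<lbrakk>\<And>i. coeff R i \<in> \<int>; R \<noteq> 0; degree R < degree P; poly P w = 0\<rbrakk> \<Longrightarrow> poly R w \<noteq> 0"
    using conjugate_integer_polynomial[OF conj(1)] unfolding \<theta>_def by metis
  have "\<exists>\<epsilon>>0. \<exists>C::nat. \<forall>x0 A n. 1 \<le> \<bar>x0\<bar> \<longrightarrow> \<bar>x0\<bar> \<le> \<theta> \<longrightarrow>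
     (\<forall>k\<in>{A..A+n}. \<bar>x0 * \<theta> ^ k - of_int (round (x0 * \<theta> ^ k))\<bar> < \<epsilon>) \<longrightarrow> n \<le> C * (A + 1)"
  proof (rule bad_run_length)
    show "z \<noteq> of_real \<theta>" using conj(2) by (simp add: \<theta>_def)
  qed (fact P \<theta> conj(3))+
  then obtain \<epsilon>0 C where \<epsilon>0: "0 < \<epsilon>0" and run: "\<And>x0 A n. 1 \<le> \<bar>x0\<bar> \<Longrightarrow> \<bar>x0\<bar> \<le> \<theta> \<Longrightarrow>
     (\<forall>k\<in>{A..A+n}. \<bar>x0 * \<theta> ^ k - of_int (round (x0 * \<theta> ^ k))\<bar> < \<epsilon>0) \<Longrightarrow> n \<le> C * (A + 1)"
    by blast
  define \<epsilon> where "\<epsilon> = min \<epsilon>0 (1 / 2)"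
  have \<epsilon>: "0 < \<epsilon>" "\<epsilon> \<le> 1 / 2" using \<epsilon>0 by (auto simp: \<epsilon>_def)
  obtain \<kappa> where \<kappa>: "0 < \<kappa>" "\<kappa> \<le> 1"
    "\<And>y. \<epsilon> \<le> \<bar>y - of_int (round y)\<bar> \<Longrightarrow> norm (1 + iexp (2 * pi * y)) \<le> 2 - \<kappa>"
    using phase_gap[OF \<epsilon>] by metis
  define L where "L = Max (l ` I)"
  have L: "l k \<le> L" if "k \<in> I" for k using that fin by (simp add: L_def)
  define c where "c = p i * p j * \<kappa>"
  have p1: "p k \<le> 1" if "k \<in> I" for k using member_le_sum[OF that, of p] fin p by (simp add: less_imp_le)
  have "p i * p j \<le> 1 * 1" using p1 p ij by (intro mult_mono) (auto simp: less_imp_le)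
  then have c: "0 < c" "c \<le> 1"
    using \<kappa> p ij mult_mono[of "p i * p j" 1 \<kappa> 1] by (auto simp: c_def)
  obtain c' T where c': "0 < c'" "c' \<le> 1"
    and reach: "\<And>(G :: nat \<Rightarrow> real) M s k. \<lbrakk>L \<le> s; 0 \<le> M; \<And>k. s \<le> k \<Longrightarrow> G k \<le> (\<Sum>i\<in>I. p i * G (k - l i));
       \<And>k. s \<le> k + L \<Longrightarrow> G k \<le> M; G s \<le> (1 - c) * M; s + T \<le> k\<rbrakk> \<Longrightarrow> G k \<le> (1 - c') * M"
  proof (rule renewal_gain_propagates[OF fin p l L Gcd c], goal_cases)
    case prems: (4 c' T)
    from prems(2-4) show ?case by (rule prems(1))
  qed
  define D where "D = 2 + 2 * L + C * (2 * L + 1) + T"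
  define \<rho> where "\<rho> = max (1 / 2) (1 - c')"
  have \<rho>: "0 < \<rho>" "\<rho> < 1" "1 - c' \<le> \<rho>" using c' by (auto simp: \<rho>_def)
  define \<gamma> where "\<gamma> = - (ln \<rho> / ln (2 * real D))"
  have "2 \<le> D" by (simp add: D_def)
  then have "0 < ln (2 * real D)" "ln \<rho> < 0" using \<rho> by auto
  then have \<gamma>: "0 < \<gamma>" by (simp add: \<gamma>_def divide_neg_pos)
  have "norm (F (w * \<theta> ^ k)) \<le> (1 / \<rho>) * real k powr (- \<gamma>)"
    if w: "1 \<le> \<bar>\<alpha> * w\<bar>" "\<bar>\<alpha> * w\<bar> \<le> \<theta>" and k: "1 \<le> k" for w k
  proof -
    define G where "G = (\<lambda>k. norm (F (w * \<theta> ^ k)))"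
    have shift: "r ^ n * (w * \<theta> ^ k) = w * \<theta> ^ (k - n)" if "n \<le> k" for n k
    proof -
      have "\<theta> ^ k = \<theta> ^ n * \<theta> ^ (k - n)" using that by (simp flip: power_add)
      moreover have "r ^ n * \<theta> ^ n = 1" using r by (simp add: \<theta>_def flip: power_mult_distrib)
      moreover have "r ^ n * (w * (\<theta> ^ n * \<theta> ^ (k - n))) = (r ^ n * \<theta> ^ n) * (w * \<theta> ^ (k - n))"
        by (simp only: mult_ac)
      ultimately show ?thesis by simp
    qed
    have rec: "G k \<le> (\<Sum>i\<in>I. p i * G (k - l i))" if "L \<le> k" for k
    proof -
      have "G k = norm (\<Sum>i\<in>I. of_real (p i) * iexp (2 * pi * (a i * (w * \<theta> ^ k))) * F (r ^ l i * (w * \<theta> ^ k)))"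
        unfolding G_def F_def by (subst fourier_self_similar[OF fin p ss]) auto
      also have "\<dots> \<le> (\<Sum>i\<in>I. p i * G (k - l i))"
      proof (rule sum_norm_le)
        fix i assume i: "i \<in> I"
        show "norm (of_real (p i) * iexp (2 * pi * (a i * (w * \<theta> ^ k))) * F (r ^ l i * (w * \<theta> ^ k))) \<le> p i * G (k - l i)"
          using L[OF i] that p(1)[OF i] by (simp add: norm_mult G_def shift)
      qed
      finally show ?thesis .
    qed
    have step: "\<forall>k\<ge>D * (A + 1). G k \<le> \<rho> * M" if M: "0 \<le> M" "\<forall>k\<ge>A. G k \<le> M" for A M
    proof -
      define A' where "A' = A + 2 * L"
      define n where "n = C * (A' + 1) + 1"
      have "\<not> (\<forall>k\<in>{A'..A'+n}. \<bar>(\<alpha> * w) * \<theta> ^ k - of_int (round ((\<alpha> * w) * \<theta> ^ k))\<bar> < \<epsilon>0)"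
        using run[OF w, of A' n] by (auto simp: n_def)
      then obtain s where s: "A' \<le> s" "s \<le> A' + n" "\<epsilon>0 \<le> \<bar>(\<alpha> * w) * \<theta> ^ s - of_int (round ((\<alpha> * w) * \<theta> ^ s))\<bar>"
        by (auto simp: not_less)
      have "norm (F (w * \<theta> ^ s)) \<le> (1 - c) * M"
        unfolding c_def F_def
      proof (rule two_word_gain[OF fin p ss ij neq])
        show "norm (1 + iexp (2 * pi * ((a i * (1 - r ^ l j) - a j * (1 - r ^ l i)) * (w * \<theta> ^ s)))) \<le> 2 - \<kappa>"
          using s(3) unfolding \<alpha>(1)[symmetric] by (intro \<kappa>(3)) (auto simp: \<epsilon>_def mult.assoc)
        show "\<kappa> \<le> 2" using \<kappa> by simp
      next
        fix k assume k: "k \<in> I"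
        have "A \<le> s - l k" "l k \<le> s" using s(1) L[OF k] by (auto simp: A'_def)
        then show "norm (fourier_transform \<mu> (r ^ l k * (w * \<theta> ^ s))) \<le> M"
          using M by (auto simp: shift G_def F_def)
      next
        fix k k' assume k: "k \<in> I" "k' \<in> I"
        have "A \<le> s - l k' - l k" "l k \<le> s - l k'" "l k' \<le> s" using s(1) L[OF k(1)] L[OF k(2)] by (auto simp: A'_def)
        then show "norm (fourier_transform \<mu> (r ^ l k * (r ^ l k' * (w * \<theta> ^ s)))) \<le> M"
          using M by (auto simp: shift G_def F_def)
      qed
      then have Gs: "G s \<le> (1 - c) * M" by (simp add: G_def)
      have "G k \<le> \<rho> * M" if k: "D * (A + 1) \<le> k" for k
      proof -
        have "s + T \<le> A' + C * (A' + 1) + 1 + T" using s by (simp add: n_def)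
        also have "\<dots> = (2 * L + C * (2 * L + 1) + 1 + T) + (1 + C) * A" by (simp add: A'_def algebra_simps)
        also have "\<dots> \<le> D + D * A"
        proof (rule add_mono)
          have "1 + C \<le> D" by (simp add: D_def)
          then show "(1 + C) * A \<le> D * A" by (rule mult_right_mono) simp
        qed (simp add: D_def)
        also have "\<dots> \<le> k" using k by simp
        finally have sk: "s + T \<le> k" .
        have "G k \<le> (1 - c') * M"
        proof (rule reach[of s M G k])
          show "L \<le> s" using s by (simp add: A'_def)
          then show "G k \<le> (\<Sum>i\<in>I. p i * G (k - l i))" if "s \<le> k" for k using rec that by auto
          show "G k \<le> M" if "s \<le> k + L" for k using M(2) s that by (auto simp: A'_def)
        qed (fact M(1) Gs sk)+
        also have "\<dots> \<le> \<rho> * M" using \<rho>(3) M(1) by (rule mult_right_mono)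
        finally show ?thesis .
      qed
      then show ?thesis by blast
    qed
    have "G k \<le> (1 / \<rho>) * real k powr (ln \<rho> / ln (2 * real D))"
      using norm_fourier_transform_le_1[OF \<mu>] step k \<rho>
      by (intro geometric_scale_decay) (auto simp: D_def G_def F_def)
    then show ?thesis by (simp add: G_def \<gamma>_def)
  qed
  then show ?thesis using \<gamma> unfolding \<theta>_def F_def by blast
qed

text \<open>Every large \<open>u\<close> is \<open>w * \<theta> ^ k\<close> with \<open>\<bar>\<alpha> * w\<bar>\<close> in \<open>[1, \<theta>]\<close> and \<open>k\<close> the integer part of the logarithm of \<open>\<bar>\<alpha> * u\<bar>\<close> in
base \<open>\<theta>\<close>, so \<open>k\<close> is at least a constant times \<open>ln \<bar>u\<bar>\<close>.\<close>

lemma logarithmic_decay_from_geometric: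
  fixes F :: "real \<Rightarrow> complex"
  assumes \<theta>: "1 < \<theta>" and \<alpha>: "\<alpha> \<noteq> 0" and \<gamma>: "0 < \<gamma>"
    and bound: "\<And>w k. 1 \<le> \<bar>\<alpha> * w\<bar> \<Longrightarrow> \<bar>\<alpha> * w\<bar> \<le> \<theta> \<Longrightarrow> 1 \<le> k \<Longrightarrow>
       norm (F (w * \<theta> ^ k)) \<le> B * real k powr (- \<gamma>)"
  shows "\<exists>C u0. 1 < u0 \<and> 0 \<le> C \<and> (\<forall>u. u0 \<le> \<bar>u\<bar> \<longrightarrow> norm (F u) \<le> C * ln \<bar>u\<bar> powr (- \<gamma>))"
proof -
  have ln\<theta>: "0 < ln \<theta>" using \<theta> by simp
  define u0 where "u0 = max 2 (max (\<theta> / \<bar>\<alpha>\<bar>) (exp (2 * \<bar>ln \<bar>\<alpha>\<bar>\<bar>)))"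
  define C where "C = \<bar>B\<bar> * (4 * ln \<theta>) powr \<gamma>"
  have "norm (F u) \<le> C * ln \<bar>u\<bar> powr (- \<gamma>)" if u: "u0 \<le> \<bar>u\<bar>" for u
  proof -
    have u2: "2 \<le> \<bar>u\<bar>" and uth: "\<theta> / \<bar>\<alpha>\<bar> \<le> \<bar>u\<bar>" and uexp: "exp (2 * \<bar>ln \<bar>\<alpha>\<bar>\<bar>) \<le> \<bar>u\<bar>"
      using u by (auto simp: u0_def)
    have lnu: "0 < ln \<bar>u\<bar>" using u2 by simp
    have lnu2: "2 * \<bar>ln \<bar>\<alpha>\<bar>\<bar> \<le> ln \<bar>u\<bar>" using uexp u2 by (simp add: ln_ge_iff)
    define v where "v = \<bar>\<alpha> * u\<bar>"
    have v: "\<theta> \<le> v" using uth \<alpha> by (simp add: v_def abs_mult divide_le_eq mult.commute)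
    have v0: "0 < v" using v \<theta> by simp
    define y where "y = log \<theta> v"
    have y1: "1 \<le> y" using v \<theta> by (simp add: y_def)
    define k where "k = nat \<lfloor>y\<rfloor>"
    have k: "1 \<le> k" "real k \<le> y" "y < real k + 1" using y1 by (auto simp: k_def le_nat_iff)
    have vy: "v = \<theta> powr y" using \<theta> v0 by (simp add: y_def)
    define w where "w = u / \<theta> ^ k"
    have aw: "\<bar>\<alpha> * w\<bar> = \<theta> powr (y - real k)"
    proof -
      have "\<bar>\<alpha> * w\<bar> = v / \<theta> ^ k" using \<theta> by (simp add: v_def w_def abs_mult)
      then show ?thesis using \<theta> by (simp add: vy powr_diff powr_realpow)
    qed
    have "1 \<le> \<theta> powr (y - real k)" "\<theta> powr (y - real k) \<le> \<theta>"
      using k \<theta> powr_mono[of 0 "y - real k" \<theta>] powr_mono[of "y - real k" 1 \<theta>] by auto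
    then have "norm (F (w * \<theta> ^ k)) \<le> B * real k powr (- \<gamma>)"
      using \<theta> by (intro bound k(1)) (auto simp: aw)
    moreover have "w * \<theta> ^ k = u" using \<theta> by (simp add: w_def)
    ultimately have 1: "norm (F u) \<le> B * real k powr (- \<gamma>)" by simp
    have "ln \<bar>u\<bar> / 2 \<le> ln v"
    proof -
      have "ln v = ln \<bar>\<alpha>\<bar> + ln \<bar>u\<bar>" using \<alpha> u2 by (simp add: v_def abs_mult ln_mult)
      then show ?thesis using lnu2 by linarith
    qed
    also have "ln v = y * ln \<theta>" using ln\<theta> by (simp add: y_def log_def)
    also have "\<dots> \<le> (2 * real k) * ln \<theta>" using k ln\<theta> by (intro mult_right_mono) auto
    finally have "ln \<bar>u\<bar> / (4 * ln \<theta>) \<le> real k" using ln\<theta> by (simp add: divide_le_eq)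
    then have "real k powr (- \<gamma>) \<le> (ln \<bar>u\<bar> / (4 * ln \<theta>)) powr (- \<gamma>)"
      using lnu ln\<theta> \<gamma> by (intro powr_mono2') auto
    also have "\<dots> = (4 * ln \<theta>) powr \<gamma> * ln \<bar>u\<bar> powr (- \<gamma>)"
      using lnu ln\<theta> by (simp add: powr_divide powr_minus field_simps)
    finally have "B * real k powr (- \<gamma>) \<le> \<bar>B\<bar> * ((4 * ln \<theta>) powr \<gamma> * ln \<bar>u\<bar> powr (- \<gamma>))"
      by (intro mult_mono) auto
    then show ?thesis using 1 by (simp add: C_def mult.assoc)
  qed
  moreover have "1 < u0" "0 \<le> C" by (auto simp: u0_def C_def)
  ultimately show ?thesis by blast
qed

section \<open>Exponential sums at almost every point\<close>

lemma norm_divide_of_nat: "norm (z / of_nat n :: complex) = norm z / real n"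
  by (simp add: norm_divide)

lemma cnj_iexp: "cnj (iexp y) = iexp (- y)"
  by (simp add: complex_eq_iff Re_exp Im_exp)

text \<open>Between \<open>k ^ q\<close> and \<open>(k + 1) ^ q\<close> the average of a sequence bounded by 1 grows in absolute value by at most
\<open>(1 + 1 / k) ^ q - 1\<close>, which tends to 0.\<close>

lemma averages_tendsto_0_from_powers:
  fixes a :: "nat \<Rightarrow> complex"
  assumes a: "\<And>n. norm (a n) \<le> 1" and q: "0 < q"
    and sub: "(\<lambda>k. (\<Sum>n=1..Suc k ^ q. a n) / of_nat (Suc k ^ q)) \<longlonglongrightarrow> 0"
  shows "(\<lambda>N. (\<Sum>n=1..N. a n) / of_nat N) \<longlonglongrightarrow> 0"
proof -
  define S where "S = (\<lambda>N. \<Sum>n=1..N. a n)"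
  define h where "h = (\<lambda>k. norm (S (Suc k ^ q) / of_nat (Suc k ^ q)) + ((1 + 1 / real (Suc k)) ^ q - 1))"
  have "(\<lambda>k. (1 + 1 / real (Suc k)) ^ q - 1) \<longlonglongrightarrow> (1 + 0) ^ q - 1"
    by (intro tendsto_intros LIMSEQ_Suc[OF lim_1_over_n])
  then have "h \<longlonglongrightarrow> 0 + ((1 + 0) ^ q - 1)"
    unfolding h_def using sub by (intro tendsto_add tendsto_norm_zero) (simp_all only: S_def)
  then have h0: "h \<longlonglongrightarrow> 0" by simp
  have le: "norm (S N / of_nat N) \<le> h k" if k: "Suc k ^ q \<le> N" "N < Suc (Suc k) ^ q" for N k
  proof -
    define K where "K = Suc k ^ q"
    define K' where "K' = Suc (Suc k) ^ q"
    have K: "0 < K" "K \<le> N" "N \<le> K'" using k by (auto simp: K_def K'_def)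
    have "S N = S K + (\<Sum>n=Suc K..N. a n)"
      unfolding S_def using K sum.ub_add_nat[of 1 K a "N - K"] by simp
    then have "norm (S N) \<le> norm (S K) + norm (\<Sum>n=Suc K..N. a n)"
      by (metis norm_triangle_ineq)
    also have "norm (\<Sum>n=Suc K..N. a n) \<le> (\<Sum>n=Suc K..N. 1)"
      by (intro sum_norm_le a)
    also have "\<dots> = real N - real K" using K by simp
    also have "\<dots> \<le> real K' - real K" using K by simp
    finally have "norm (S N) \<le> norm (S K) + (real K' - real K)" by simp
    then have "norm (S N) / real N \<le> (norm (S K) + (real K' - real K)) / real K"
      using K by (intro frac_le) auto
    also have "\<dots> = norm (S K) / real K + (real K' / real K - 1)"
      using K by (simp add: add_divide_distrib diff_divide_distrib)
    also have "real K' / real K = (real (Suc (Suc k)) / real (Suc k)) ^ q"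
      by (simp add: K_def K'_def power_divide)
    also have "real (Suc (Suc k)) / real (Suc k) = 1 + 1 / real (Suc k)"
      by (simp add: field_simps)
    finally show ?thesis unfolding h_def norm_divide_of_nat by (simp only: K_def)
  qed
  show ?thesis
  proof (rule LIMSEQ_I)
    fix e :: real assume "0 < e"
    then obtain K where K: "\<And>k. K \<le> k \<Longrightarrow> h k < e"
      using LIMSEQ_D[OF h0] by (metis abs_less_iff diff_zero real_norm_def)
    show "\<exists>no. \<forall>N\<ge>no. norm ((\<Sum>n=1..N. a n) / of_nat N - 0) < e"
    proof (intro exI allI impI)
      fix N assume N: "Suc K ^ q \<le> N"
      define j where "j = (LEAST j. N < j ^ q)"
      have "N < Suc N ^ q" using q self_le_power[of "Suc N" q] by simp
      then have j: "N < j ^ q" unfolding j_def by (rule LeastI)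
      have jmin: "i ^ q \<le> N" if "i < j" for i
        using not_less_Least[of i "\<lambda>j. N < j ^ q"] that by (auto simp: j_def)
      have "Suc K < j"
      proof (rule ccontr)
        assume "\<not> Suc K < j"
        then have "j ^ q \<le> Suc K ^ q" by (intro power_mono) auto
        then show False using j N by simp
      qed
      then obtain k where k: "j = Suc (Suc k)" "K \<le> k" by (cases j; cases "j - 1") auto
      have "norm (S N / of_nat N) \<le> h k" using jmin[of "Suc k"] j k by (intro le) auto
      also have "\<dots> < e" using K k by simp
      finally show "norm ((\<Sum>n=1..N. a n) / of_nat N - 0) < e" by (simp add: S_def)
    qed
  qed
qed

lemma (in prob_space) second_moment_bound:
  fixes f :: "nat \<Rightarrow> 'a \<Rightarrow> complex"
  assumes f[measurable]: "\<And>n. f n \<in> borel_measurable M" and f1: "\<And>n x. norm (f n x) \<le> 1"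
    and C: "0 \<le> C" and \<gamma>: "\<gamma> \<le> 1"
    and corr: "\<And>n m. 1 \<le> n \<Longrightarrow> n < m \<Longrightarrow> norm (CLINT x|M. f m x * cnj (f n x)) \<le> C * real m powr (- \<gamma>)"
  shows "(\<integral>x. (norm (\<Sum>n=1..N. f n x))\<^sup>2 \<partial>M) \<le> real N * (1 + 2 * C * real N powr (1 - \<gamma>))"
proof (induction N)
  case (Suc N)
  have [measurable]: "cnj \<in> borel_measurable borel"
    by (intro borel_measurable_continuous_onI continuous_intros)
  define S where "S = (\<lambda>x. \<Sum>n=1..N. f n x)"
  have [measurable]: "S \<in> borel_measurable M" unfolding S_def by measurable
  have SN: "norm (S x) \<le> real N" for x
  proof -
    have "norm (S x) \<le> (\<Sum>n=1..N. 1)" unfolding S_def by (intro sum_norm_le f1)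
    then show ?thesis by simp
  qed
  have i1: "integrable M (\<lambda>x. (norm (S x))\<^sup>2)"
    by (rule integrable_const_bound[of _ "(real N)\<^sup>2"]) (auto intro!: power_mono SN)
  have i2: "integrable M (\<lambda>x. f m x * cnj (f n x))" for m n
    by (rule integrable_const_bound[of _ 1]) (auto intro!: mult_le_one f1 simp: norm_mult)
  have eqS: "f (Suc N) x * cnj (S x) = (\<Sum>n=1..N. f (Suc N) x * cnj (f n x))" for x
    by (simp add: S_def sum_distrib_left)
  have i3: "integrable M (\<lambda>x. f (Suc N) x * cnj (S x))"
    unfolding eqS by (intro Bochner_Integration.integrable_sum i2)
  have i4: "integrable M (\<lambda>x. (norm (f (Suc N) x))\<^sup>2)"
    by (rule integrable_const_bound[of _ 1]) (auto intro!: power_le_one f1)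
  define R where "R = (\<lambda>x. Re (f (Suc N) x * cnj (S x)))"
  have iR: "integrable M R" unfolding R_def using i3 by (rule integrable_Re)
  have sq: "(norm (z + w))\<^sup>2 = (norm z)\<^sup>2 + 2 * Re (w * cnj z) + (norm w)\<^sup>2" for z w :: complex
    unfolding cmod_power2 by (simp add: power2_eq_square algebra_simps)
  have expand: "(norm (\<Sum>n=1..Suc N. f n x))\<^sup>2 = (norm (S x))\<^sup>2 + 2 * R x + (norm (f (Suc N) x))\<^sup>2" for x
    using sq[of "S x" "f (Suc N) x"] by (simp add: S_def R_def)
  have "(\<integral>x. (norm (\<Sum>n=1..Suc N. f n x))\<^sup>2 \<partial>M)
      = (\<integral>x. (norm (S x))\<^sup>2 \<partial>M) + 2 * (\<integral>x. R x \<partial>M) + (\<integral>x. (norm (f (Suc N) x))\<^sup>2 \<partial>M)"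
    unfolding expand using i1 iR i4 by simp
  also have "(\<integral>x. (norm (f (Suc N) x))\<^sup>2 \<partial>M) \<le> (\<integral>x. 1 \<partial>M)"
    using i4 by (intro integral_mono) (auto simp: f1 power_le_one)
  also have "(\<integral>x. 1 \<partial>M) = (1::real)" by (simp add: prob_space)
  also have "(\<integral>x. R x \<partial>M) = Re (CLINT x|M. f (Suc N) x * cnj (S x))"
    unfolding R_def using i3 by (rule integral_Re)
  also have "\<dots> \<le> norm (CLINT x|M. f (Suc N) x * cnj (S x))" by (rule complex_Re_le_cmod)
  also have "(CLINT x|M. f (Suc N) x * cnj (S x)) = (\<Sum>n=1..N. CLINT x|M. f (Suc N) x * cnj (f n x))"
    unfolding eqS by (intro Bochner_Integration.integral_sum i2)
  also have "norm (\<Sum>n=1..N. CLINT x|M. f (Suc N) x * cnj (f n x)) \<le> (\<Sum>n=1..N. C * real (Suc N) powr (- \<gamma>))"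
    by (intro sum_norm_le corr) auto
  also have "\<dots> = C * (real N * real (Suc N) powr (- \<gamma>))" by simp
  also have "\<dots> \<le> C * (real (Suc N) powr 1 * real (Suc N) powr (- \<gamma>))"
    using C by (intro mult_left_mono mult_right_mono) auto
  also have "real (Suc N) powr 1 * real (Suc N) powr (- \<gamma>) = real (Suc N) powr (1 - \<gamma>)"
    by (simp only: powr_add[symmetric] diff_conv_add_uminus)
  also have "(\<integral>x. (norm (S x))\<^sup>2 \<partial>M) \<le> real N * (1 + 2 * C * real N powr (1 - \<gamma>))"
    using Suc.IH by (simp add: S_def)
  also have "\<dots> \<le> real N * (1 + 2 * C * real (Suc N) powr (1 - \<gamma>))"
    using C \<gamma> by (intro mult_left_mono add_left_mono powr_mono2) auto
  finally show ?case by (simp add: algebra_simps)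
qed simp

text \<open>The second moments of the averages are \<open>O (N powr - \<gamma>)\<close>. With \<open>q * \<gamma> \<ge> 2\<close> they are summable along
\<open>N = k ^ q\<close>, so almost surely the squared averages are summable along these \<open>N\<close>, and in particular
tend to 0.\<close>

lemma (in prob_space) correlation_decay_imp_averages_tendsto_0:
  fixes f :: "nat \<Rightarrow> 'a \<Rightarrow> complex"
  assumes f[measurable]: "\<And>n. f n \<in> borel_measurable M" and f1: "\<And>n x. norm (f n x) \<le> 1"
    and C: "0 \<le> C" and \<gamma>: "0 < \<gamma>" "\<gamma> \<le> 1"
    and corr: "\<And>n m. 1 \<le> n \<Longrightarrow> n < m \<Longrightarrow> norm (CLINT x|M. f m x * cnj (f n x)) \<le> C * real m powr (- \<gamma>)"
  shows "AE x in M. (\<lambda>N. (\<Sum>n=1..N. f n x) / of_nat N) \<longlonglongrightarrow> 0"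
proof -
  define q where "q = nat \<lceil>2 / \<gamma>\<rceil>"
  have q: "2 \<le> real q * \<gamma>"
  proof -
    have "2 / \<gamma> \<le> real q" unfolding q_def by linarith
    then show ?thesis using \<gamma> by (simp add: divide_le_eq)
  qed
  then have q0: "0 < q" by (cases q) auto
  define g where "g = (\<lambda>k x. (norm ((\<Sum>n=1..Suc k ^ q. f n x) / of_nat (Suc k ^ q)))\<^sup>2)"
  have [measurable]: "g k \<in> borel_measurable M" for k unfolding g_def by measurable
  have g0: "0 \<le> g k x" for k x by (simp add: g_def)
  have g1: "g k x \<le> 1" for k x
  proof -
    define N where "N = Suc k ^ q"
    have "0 < N" by (simp add: N_def)
    have "norm (\<Sum>n=1..N. f n x) \<le> (\<Sum>n=1..N. 1)" by (intro sum_norm_le f1)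
    then have "norm ((\<Sum>n=1..N. f n x) / of_nat N) \<le> 1"
      using \<open>0 < N\<close> by (simp add: norm_divide divide_le_eq)
    then show ?thesis unfolding g_def N_def by (rule power_le_one[OF norm_ge_zero])
  qed
  have gi: "integrable M (g k)" for k
    by (rule integrable_const_bound[of _ 1]) (auto simp: g0 g1)
  have gE: "(\<integral>x. g k x \<partial>M) \<le> (1 + 2 * C) * (1 / real (Suc k) ^ 2)" for k
  proof -
    define N where "N = Suc k ^ q"
    have N: "1 \<le> real N" by (simp add: N_def)
    have "(\<integral>x. g k x \<partial>M) = (\<integral>x. (norm (\<Sum>n=1..N. f n x))\<^sup>2 / (real N)\<^sup>2 \<partial>M)"
      unfolding g_def norm_divide_of_nat N_def[symmetric] by (simp add: power_divide)
    also have "\<dots> = (\<integral>x. (norm (\<Sum>n=1..N. f n x))\<^sup>2 \<partial>M) / (real N)\<^sup>2" by simp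
    also have "\<dots> \<le> (real N * (1 + 2 * C * real N powr (1 - \<gamma>))) / (real N)\<^sup>2"
      using second_moment_bound[OF f f1 C \<gamma>(2) corr] by (intro divide_right_mono) auto
    also have "\<dots> = (1 + 2 * C * real N powr (1 - \<gamma>)) / real N"
      using N by (simp add: power2_eq_square)
    also have "\<dots> \<le> ((1 + 2 * C) * real N powr (1 - \<gamma>)) / real N"
    proof (intro divide_right_mono)
      have "1 \<le> real N powr (1 - \<gamma>)" using N \<gamma> by (intro ge_one_powr_ge_zero) auto
      then show "1 + 2 * C * real N powr (1 - \<gamma>) \<le> (1 + 2 * C) * real N powr (1 - \<gamma>)"
        by (simp add: algebra_simps)
    qed simp
    also have "\<dots> = (1 + 2 * C) * real N powr (- \<gamma>)"
      using N by (simp add: powr_diff powr_minus divide_inverse)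
    also have "real N powr (- \<gamma>) = real (Suc k) powr (- (real q * \<gamma>))"
      by (simp add: N_def powr_powr flip: powr_realpow)
    also have "\<dots> \<le> real (Suc k) powr (- 2)" using q by (intro powr_mono) auto
    also have "\<dots> = 1 / real (Suc k) ^ 2" by (simp add: powr_minus divide_inverse)
    finally show ?thesis using C by (simp add: mult_left_mono)
  qed
  have summ: "summable (\<lambda>k. (1 + 2 * C) * (1 / real (Suc k) ^ 2))"
    by (intro summable_mult) (use inverse_power_summable[of 2, where 'a=real] summable_Suc_iff[of "\<lambda>n. 1 / real n ^ 2"] in \<open>simp add: inverse_eq_divide\<close>)
  have "(\<integral>\<^sup>+x. (\<Sum>k. ennreal (g k x)) \<partial>M) = (\<Sum>k. \<integral>\<^sup>+x. ennreal (g k x) \<partial>M)"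
    by (intro nn_integral_suminf) measurable
  also have "\<dots> = (\<Sum>k. ennreal (\<integral>x. g k x \<partial>M))"
    using gi g0 by (intro suminf_cong nn_integral_eq_integral) auto
  also have "\<dots> \<le> (\<Sum>k. ennreal ((1 + 2 * C) * (1 / real (Suc k) ^ 2)))"
    using gE by (intro suminf_le ennreal_leI) auto
  also have "\<dots> = ennreal (\<Sum>k. (1 + 2 * C) * (1 / real (Suc k) ^ 2))"
    using C summ by (intro suminf_ennreal2) auto
  finally have "(\<integral>\<^sup>+x. (\<Sum>k. ennreal (g k x)) \<partial>M) \<noteq> \<infinity>"
    by (metis ennreal_neq_top infinity_ennreal_def neq_top_trans)
  then have "AE x in M. (\<Sum>k. ennreal (g k x)) \<noteq> \<infinity>"
    by (intro nn_integral_PInf_AE) measurable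
  then show ?thesis
  proof eventually_elim
    case (elim x)
    then have "summable (\<lambda>k. g k x)" using g0 by (intro summable_suminf_not_top) auto
    then have "(\<lambda>k. g k x) \<longlonglongrightarrow> 0" by (rule summable_LIMSEQ_zero)
    then have "(\<lambda>k. sqrt (g k x)) \<longlonglongrightarrow> sqrt 0" by (intro tendsto_intros)
    then have "(\<lambda>k. norm ((\<Sum>n=1..Suc k ^ q. f n x) / of_nat (Suc k ^ q))) \<longlonglongrightarrow> 0"
      by (simp add: g_def)
    then have "(\<lambda>k. (\<Sum>n=1..Suc k ^ q. f n x) / of_nat (Suc k ^ q)) \<longlonglongrightarrow> 0"
      by (rule tendsto_norm_zero_cancel)
    then show ?case by (intro averages_tendsto_0_from_powers[OF f1 q0])
  qed
qed

text \<open>The frequency has absolute value at least \<open>2 ^ (m - 1)\<close>, so its logarithm is at least a multiple of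
\<open>m\<close>. The finitely many \<open>m\<close> for which the frequency may lie below \<open>u0\<close> are absorbed in the constant.\<close>

lemma fourier_decay_imp_correlation_decay:
  fixes b :: nat and h :: int
  assumes M: "prob_space M" "sets M = sets borel" and b: "2 \<le> b" and h: "h \<noteq> 0"
    and \<gamma>: "0 < \<gamma>" "\<gamma> \<le> 1" and C: "0 \<le> C"
    and decay: "\<And>u. u0 \<le> \<bar>u\<bar> \<Longrightarrow> norm (fourier_transform M u) \<le> C * ln \<bar>u\<bar> powr (- \<gamma>)"
  obtains C' where "0 \<le> C'" "\<And>n m. 1 \<le> n \<Longrightarrow> n < m \<Longrightarrow>
    norm (fourier_transform M (of_int h * (real b ^ m - real b ^ n))) \<le> C' * real m powr (- \<gamma>)"
proof -
  define m0 where "m0 = nat \<lceil>u0\<rceil> + 1"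
  define C' where "C' = real m0 powr \<gamma> + C * (ln 2 / 2) powr (- \<gamma>)"
  have bound: "norm (fourier_transform M (of_int h * (real b ^ m - real b ^ n))) \<le> C' * real m powr (- \<gamma>)"
    if n: "1 \<le> n" and nm: "n < m" for n m
  proof (cases "m \<le> m0")
    case True
    have "norm (fourier_transform M (of_int h * (real b ^ m - real b ^ n))) \<le> 1"
      by (rule norm_fourier_transform_le_1[OF M])
    also have "1 \<le> real m0 powr \<gamma> * real m powr (- \<gamma>)"
    proof -
      have "real m powr \<gamma> \<le> real m0 powr \<gamma>" using True \<gamma> by (intro powr_mono2) auto
      then show ?thesis using nm by (simp add: powr_minus field_simps)
    qed
    also have "\<dots> \<le> C' * real m powr (- \<gamma>)" using C by (intro mult_right_mono) (auto simp: C'_def)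
    finally show ?thesis .
  next
    case False
    define u where "u = of_int h * (real b ^ m - real b ^ n)"
    have "real b ^ n \<le> real b ^ (m - 1)" using b nm by (intro power_increasing) auto
    moreover have "real b ^ m = real b * real b ^ (m - 1)" using nm by (cases m) auto
    moreover have "2 * real b ^ (m - 1) \<le> real b * real b ^ (m - 1)" using b by (intro mult_right_mono) auto
    ultimately have d: "real b ^ (m - 1) \<le> real b ^ m - real b ^ n" by linarith
    have "2 ^ (m - 1) \<le> real b ^ (m - 1)" using b by (intro power_mono) auto
    also have "\<dots> \<le> 1 * \<bar>real b ^ m - real b ^ n\<bar>" using d by simp
    also have "\<dots> \<le> \<bar>of_int h\<bar> * \<bar>real b ^ m - real b ^ n\<bar>" using h by (intro mult_right_mono) auto
    finally have u: "2 ^ (m - 1) \<le> \<bar>u\<bar>" by (simp add: u_def abs_mult)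
    have "real (m - 1) \<le> 2 ^ (m - 1)" by (rule less_imp_le[OF of_nat_less_two_power])
    moreover have "u0 \<le> real (m - 1)" using False unfolding m0_def by linarith
    ultimately have "u0 \<le> \<bar>u\<bar>" using u by linarith
    then have "norm (fourier_transform M u) \<le> C * ln \<bar>u\<bar> powr (- \<gamma>)" by (rule decay)
    also have "\<dots> \<le> C * (ln 2 / 2 * real m) powr (- \<gamma>)"
    proof (intro mult_left_mono powr_mono2')
      have "ln 2 / 2 * real m \<le> ln 2 * real (m - 1)" using n nm by simp
      also have "\<dots> = ln (2 ^ (m - 1))" by (simp add: ln_realpow)
      also have "\<dots> \<le> ln \<bar>u\<bar>" using u by (intro ln_mono) auto
      finally show "ln 2 / 2 * real m \<le> ln \<bar>u\<bar>" .
    qed (use C \<gamma> nm in auto)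
    also have "(ln 2 / 2 * real m) powr (- \<gamma>) = (ln 2 / 2) powr (- \<gamma>) * real m powr (- \<gamma>)"
      by (rule powr_mult)
    also have "C * \<dots> = C * (ln 2 / 2) powr (- \<gamma>) * real m powr (- \<gamma>)" by simp
    also have "\<dots> \<le> C' * real m powr (- \<gamma>)" by (intro mult_right_mono) (auto simp: C'_def)
    finally show ?thesis by (simp add: u_def)
  qed
  have "0 \<le> C'" using C by (simp add: C'_def)
  with bound show thesis using that by blast
qed

lemma fourier_decay_imp_exponential_averages:
  fixes b :: nat and h :: int
  assumes M: "prob_space M" "sets M = sets borel" and b: "2 \<le> b" and h: "h \<noteq> 0"
    and \<gamma>: "0 < \<gamma>" "\<gamma> \<le> 1" and C: "0 \<le> C"
    and decay: "\<And>u. u0 \<le> \<bar>u\<bar> \<Longrightarrow> norm (fourier_transform M u) \<le> C * ln \<bar>u\<bar> powr (- \<gamma>)"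
  shows "AE x in M. (\<lambda>N. (\<Sum>n=1..N. iexp (2 * pi * (of_int h * (x * real b ^ n)))) / of_nat N) \<longlonglongrightarrow> 0"
proof -
  interpret prob_space M by (rule M)
  note [measurable_cong] = M(2)
  obtain C' where C': "0 \<le> C'" "\<And>n m. 1 \<le> n \<Longrightarrow> n < m \<Longrightarrow>
    norm (fourier_transform M (of_int h * (real b ^ m - real b ^ n))) \<le> C' * real m powr (- \<gamma>)"
    using fourier_decay_imp_correlation_decay[OF M b h \<gamma> C decay] by metis
  show ?thesis
  proof (rule correlation_decay_imp_averages_tendsto_0[OF _ _ C'(1) \<gamma>])
    fix n m :: nat assume nm: "1 \<le> n" "n < m"
    have "iexp (2 * pi * (of_int h * (x * real b ^ m))) * cnj (iexp (2 * pi * (of_int h * (x * real b ^ n))))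
       = iexp (2 * pi * (of_int h * (real b ^ m - real b ^ n)) * x)" for x
      unfolding cnj_iexp exp_add[symmetric] by (simp add: algebra_simps)
    then show "norm (CLINT x|M. iexp (2 * pi * (of_int h * (x * real b ^ m))) * cnj (iexp (2 * pi * (of_int h * (x * real b ^ n)))))
       \<le> C' * real m powr (- \<gamma>)"
      using C'(2)[OF nm] by (simp only: fourier_transform_def)
  qed auto
qed

section \<open>The Weyl criterion\<close>

definition circle_pt :: "real \<Rightarrow> complex" where "circle_pt s = iexp (2 * pi * s)"

definition unit_unif :: "real measure" where "unit_unif = uniform_measure lborel {0..1}"

lemma prob_space_unit_unif: "prob_space unit_unif"
  unfolding unit_unif_def by (rule prob_space_uniform_measure) auto

lemma sets_unit_unif [measurable_cong]: "sets unit_unif = sets borel"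
  by (simp add: unit_unif_def)

lemma unit_unif_density: "unit_unif = density lborel (\<lambda>x. ennreal (indicator {0..1} x))"
  unfolding unit_unif_def uniform_measure_def by (simp add: ennreal_indicator divide_ennreal_def)

lemma circle_pt_measurable [measurable]: "circle_pt \<in> borel_measurable borel"
  unfolding circle_pt_def by measurable

lemma norm_circle_pt [simp]: "norm (circle_pt s) = 1"
  by (simp add: circle_pt_def)

lemma circle_pt_add_int: "circle_pt (s + of_int k) = circle_pt s"
proof -
  have "circle_pt (s + of_int k) = circle_pt s * exp (2 * of_int k * pi * \<i>)"
    unfolding circle_pt_def exp_add[symmetric] by (simp add: algebra_simps)
  then show ?thesis by (simp only: exp_integer_2pi[OF Ints_of_int] mult_1_right)
qed

lemma circle_pt_frac: "circle_pt (frac s) = circle_pt s"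
  using circle_pt_add_int[of "frac s" "\<lfloor>s\<rfloor>"] by (simp add: frac_def)

lemma circle_pt_eq_iff: "circle_pt s = circle_pt s' \<longleftrightarrow> (\<exists>k::int. s = s' + of_int k)"
proof
  assume "circle_pt s = circle_pt s'"
  then obtain n :: int where "\<i> * of_real (2 * pi * s) = \<i> * of_real (2 * pi * s') + (of_int (2 * n) * pi) * \<i>"
    unfolding circle_pt_def exp_eq by auto
  then have "Im (\<i> * of_real (2 * pi * s)) = Im (\<i> * of_real (2 * pi * s') + (of_int (2 * n) * pi) * \<i>)" by simp
  then have "2 * pi * s = 2 * pi * (s' + of_int n)" by (simp add: algebra_simps)
  then have "s = s' + of_int n" by simp
  then show "\<exists>k::int. s = s' + of_int k" ..
qed (auto simp: circle_pt_add_int)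

lemma integral_character_unit_unif:
  assumes k: "k \<noteq> (0::int)"
  shows "(CLINT s|unit_unif. iexp (2 * pi * (of_int k * s))) = 0"
proof -
  define c where "c = 2 * pi * of_int k"
  have c: "c \<noteq> 0" using k by (simp add: c_def)
  have "((\<lambda>s. iexp (c * s) / (\<i> * of_real c)) has_vector_derivative iexp (c * s)) (at s within {0..1})" for s
  proof -
    have "((\<lambda>s. exp (\<i> * of_real c * s) / (\<i> * of_real c)) has_field_derivative exp (\<i> * of_real c * of_real s)) (at (of_real s))"
      by (rule derivative_eq_intros refl | use c in simp)+
    from has_vector_derivative_real_field[OF this]
    show ?thesis by (simp add: mult.assoc)
  qed
  then have "has_bochner_integral lborel (\<lambda>s. indicator {0..1} s *\<^sub>R iexp (c * s)) (iexp (c * 1) / (\<i> * of_real c) - iexp (c * 0) / (\<i> * of_real c))"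
    by (intro has_bochner_integral_FTC_Icc continuous_intros) auto
  moreover have "iexp (c * 1) = 1"
    using exp_integer_2pi[of "of_int k"] by (simp add: c_def mult_ac)
  ultimately have "(CLINT s|lborel. indicator {0..1} s *\<^sub>R iexp (c * s)) = 0"
    using has_bochner_integral_integral_eq by fastforce
  then show ?thesis
    unfolding unit_unif_density by (simp add: integral_density c_def mult.assoc)
qed

inductive trig_poly :: "(complex \<Rightarrow> complex) \<Rightarrow> bool" where
  monom: "trig_poly (\<lambda>z. c * z ^ j * cnj z ^ k)"
| add: "trig_poly f \<Longrightarrow> trig_poly g \<Longrightarrow> trig_poly (\<lambda>z. f z + g z)"

text \<open>Closure under products lets real polynomials in the two coordinates of a point be handled as
trigonometric polynomials on the circle.\<close>

lemma trig_poly_mult: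
  assumes "trig_poly f" "trig_poly g"
  shows "trig_poly (\<lambda>z. f z * g z)"
  using assms
proof (induction arbitrary: g)
  case (monom c j k)
  show ?case using monom
  proof induction
    case (monom c' j' k')
    have "(\<lambda>z. (c * z ^ j * cnj z ^ k) * (c' * z ^ j' * cnj z ^ k')) = (\<lambda>z. (c * c') * z ^ (j + j') * cnj z ^ (k + k'))"
      by (simp add: power_add mult_ac)
    then show ?case by (simp only: trig_poly.monom)
  next
    case (add f g)
    then show ?case unfolding distrib_left by (intro trig_poly.add)
  qed
next
  case (add f1 f2)
  then show ?case unfolding distrib_right by (intro trig_poly.add) auto
qed

lemma trig_poly_real_polynomial:
  fixes g :: "complex \<Rightarrow> real"
  assumes "real_polynomial_function g"
  shows "trig_poly (\<lambda>z. of_real (g z))"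
  using assms
proof induction
  case (linear f)
  interpret bounded_linear f by fact
  have f: "f z = Re z * f 1 + Im z * f \<i>" for z
  proof -
    have "f z = f (Re z *\<^sub>R 1 + Im z *\<^sub>R \<i>)" by (rule arg_cong[of _ _ f]) (simp add: complex_eq_iff)
    then show ?thesis by (simp add: add scaleR)
  qed
  have "(\<lambda>z. of_real (f z)) = (\<lambda>z. ((of_real (f 1) - \<i> * of_real (f \<i>)) / 2) * z ^ 1 * cnj z ^ 0 + ((of_real (f 1) + \<i> * of_real (f \<i>)) / 2) * z ^ 0 * cnj z ^ 1)"
    by (rule ext, subst f) (simp add: complex_eq_iff field_simps)
  then show ?case by (simp only: trig_poly.intros)
next
  case (const c)
  then show ?case using trig_poly.monom[of "of_real c" 0 0] by simp
next
  case (add f g)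
  then show ?case using trig_poly.add by simp
next
  case (mult f g)
  then show ?case using trig_poly_mult by simp
qed

context
  fixes t :: "nat \<Rightarrow> real"
  assumes weyl: "\<And>h::int. h \<noteq> 0 \<Longrightarrow> (\<lambda>N. (\<Sum>n=1..N. iexp (2 * pi * (of_int h * t n))) / of_nat N) \<longlonglongrightarrow> 0"
begin

text \<open>On the circle the monomial \<open>z ^ j * cnj z ^ k\<close> is the character of frequency \<open>j - k\<close>.\<close>

lemma trig_poly_averages:
  assumes "trig_poly g"
  shows "integrable unit_unif (\<lambda>s. g (circle_pt s)) \<and>
    (\<lambda>N. (\<Sum>n=1..N. g (circle_pt (t n))) / of_nat N) \<longlonglongrightarrow> (CLINT s|unit_unif. g (circle_pt s))"
  using assms
proof induction
  case (monom c j k)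
  interpret prob_space unit_unif by (rule prob_space_unit_unif)
  define h where "h = int j - int k"
  have eq: "c * circle_pt s ^ j * cnj (circle_pt s) ^ k = c * iexp (2 * pi * (of_int h * s))" for s
  proof -
    have "cnj (circle_pt s) = iexp (- (2 * pi * s))"
      unfolding circle_pt_def by (rule cnj_iexp)
    then have "circle_pt s ^ j * cnj (circle_pt s) ^ k = iexp (2 * pi * (of_int h * s))"
      unfolding circle_pt_def by (simp add: h_def algebra_simps flip: exp_of_nat_mult exp_add)
    then show ?thesis by (simp add: mult.assoc)
  qed
  have int: "integrable unit_unif (\<lambda>s. iexp (2 * pi * (of_int h * s)))"
    by (rule integrable_const_bound[of _ 1]) auto
  have "(\<lambda>N. (\<Sum>n=1..N. iexp (2 * pi * (of_int h * t n))) / of_nat N) \<longlonglongrightarrow> (CLINT s|unit_unif. iexp (2 * pi * (of_int h * s)))"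
  proof (cases "h = 0")
    case True
    have "\<forall>\<^sub>F N in sequentially. (\<Sum>n=1..N. iexp (2 * pi * (of_int h * t n))) / of_nat N = 1"
      using eventually_gt_at_top[of 0] by eventually_elim (simp add: True)
    then show ?thesis using True by (simp add: prob_space tendsto_eventually)
  next
    case False
    then show ?thesis using weyl[OF False] integral_character_unit_unif[OF False] by simp
  qed
  then have "(\<lambda>N. c * ((\<Sum>n=1..N. iexp (2 * pi * (of_int h * t n))) / of_nat N)) \<longlonglongrightarrow> c * (CLINT s|unit_unif. iexp (2 * pi * (of_int h * s)))"
    by (intro tendsto_intros)
  then show ?case unfolding eq using int by (simp add: sum_distrib_left)
next
  case (add f g)
  then have "(\<lambda>N. (\<Sum>n=1..N. f (circle_pt (t n))) / of_nat N + (\<Sum>n=1..N. g (circle_pt (t n))) / of_nat N)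
    \<longlonglongrightarrow> (CLINT s|unit_unif. f (circle_pt s)) + (CLINT s|unit_unif. g (circle_pt s))"
    by (intro tendsto_add) auto
  then show ?case using add by (simp add: sum.distrib add_divide_distrib)
qed

text \<open>By the Stone-Weierstrass theorem a continuous function on the circle is uniformly close to a real
polynomial, hence to a trigonometric polynomial.\<close>

lemma continuous_averages_upper:
  fixes G :: "complex \<Rightarrow> real"
  assumes G: "continuous_on (sphere 0 1) G" and Gm: "integrable unit_unif (\<lambda>s. G (circle_pt s))" and e: "0 < e"
  shows "\<forall>\<^sub>F N in sequentially. (\<Sum>n=1..N. G (circle_pt (t n))) \<le> real N * ((\<integral>s. G (circle_pt s) \<partial>unit_unif) + e)"
proof -
  interpret prob_space unit_unif by (rule prob_space_unit_unif)
  obtain g where g: "real_polynomial_function g" "\<And>z. z \<in> sphere 0 1 \<Longrightarrow> \<bar>G z - g z\<bar> < e / 3"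
    using Stone_Weierstrass_real_polynomial_function[of "sphere 0 1" G "e / 3"] G e by auto
  define I where "I = (\<integral>s. g (circle_pt s) \<partial>unit_unif)"
  have gG: "\<bar>G (circle_pt s) - g (circle_pt s)\<bar> < e / 3" for s using g(2)[of "circle_pt s"] by simp
  have gG1: "G (circle_pt s) \<le> g (circle_pt s) + e / 3" and gG2: "g (circle_pt s) \<le> G (circle_pt s) + e / 3" for s
    using gG[of s] by linarith+
  note tp = trig_poly_averages[OF trig_poly_real_polynomial[OF g(1)]]
  have gi: "integrable unit_unif (\<lambda>s. g (circle_pt s))"
    using integrable_Re[OF conjunct1[OF tp]] by simp
  have "I \<le> (\<integral>s. G (circle_pt s) + e / 3 \<partial>unit_unif)"
    unfolding I_def using gi Gm gG2 by (intro integral_mono) auto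
  also have "\<dots> = (\<integral>s. G (circle_pt s) \<partial>unit_unif) + e / 3" using Gm by (simp add: prob_space)
  finally have I: "I \<le> (\<integral>s. G (circle_pt s) \<partial>unit_unif) + e / 3" .
  have "(\<lambda>N. Re ((\<Sum>n=1..N. of_real (g (circle_pt (t n)))) / of_nat N)) \<longlonglongrightarrow> Re (CLINT s|unit_unif. of_real (g (circle_pt s)))"
    using tp by (intro tendsto_intros) auto
  also have "(\<lambda>N. Re ((\<Sum>n=1..N. of_real (g (circle_pt (t n)))) / of_nat N)) = (\<lambda>N. (\<Sum>n=1..N. g (circle_pt (t n))) / real N)"
    by (simp flip: of_real_sum)
  finally have "(\<lambda>N. (\<Sum>n=1..N. g (circle_pt (t n))) / real N) \<longlonglongrightarrow> I"
    by (simp add: I_def)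
  then have "\<forall>\<^sub>F N in sequentially. (\<Sum>n=1..N. g (circle_pt (t n))) / real N < I + e / 3"
    using e by (intro order_tendstoD(2)) auto
  then show ?thesis using eventually_gt_at_top[of 0]
  proof eventually_elim
    case (elim N)
    have "(\<Sum>n=1..N. G (circle_pt (t n))) \<le> (\<Sum>n=1..N. g (circle_pt (t n)) + e / 3)"
      using gG1 by (intro sum_mono)
    also have "\<dots> = (\<Sum>n=1..N. g (circle_pt (t n))) + real N * (e / 3)"
      by (simp add: sum.distrib)
    also have "(\<Sum>n=1..N. g (circle_pt (t n))) \<le> real N * (I + e / 3)"
      using elim by (simp add: divide_less_eq mult.commute less_imp_le)
    also have "real N * (I + e / 3) + real N * (e / 3) \<le> real N * ((\<integral>s. G (circle_pt s) \<partial>unit_unif) + e)"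
      unfolding distrib_left[symmetric] using I by (intro mult_left_mono) auto
    finally show ?case by simp
  qed
qed

text \<open>The indicator of the closed arc over \<open>{a..b}\<close> is a decreasing limit of continuous functions of the
distance to the arc, whose integrals tend to the length of the arc. Working on the circle rather
than on \<open>{0..1}\<close> avoids treating the end points separately: they only contribute the null set \<open>{0, 1}\<close>.\<close>

lemma closed_interval_count_upper:
  assumes ab: "0 \<le> a" "a \<le> b" "b \<le> 1" and e: "0 < e"
  shows "\<forall>\<^sub>F N in sequentially. real (card {n\<in>{1..N}. frac (t n) \<in> {a..b}}) \<le> real N * ((b - a) + e)"
proof -
  interpret prob_space unit_unif by (rule prob_space_unit_unif)
  define S where "S = circle_pt ` {a..b}"
  have "continuous_on {a..b} circle_pt" unfolding circle_pt_def by (intro continuous_intros)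
  then have "compact S" unfolding S_def by (intro compact_continuous_image) auto
  then have S: "closed S" "S \<noteq> {}" using ab by (auto simp: S_def compact_imp_closed)
  define G where "G = (\<lambda>k z. max 0 (1 - real k * infdist z S))"
  have G01: "0 \<le> G k z" "G k z \<le> 1" for k z by (auto simp: G_def infdist_nonneg)
  have Gc: "continuous_on A (G k)" for A k unfolding G_def by (intro continuous_intros)
  have [measurable]: "G k \<in> borel_measurable borel" for k by (intro borel_measurable_continuous_onI Gc)
  have Gi: "integrable unit_unif (\<lambda>s. G k (circle_pt s))" for k
    by (rule integrable_const_bound[of _ 1]) (auto simp: G01)
  have [measurable]: "S \<in> sets borel" using S by auto
  have "(\<lambda>k. G k z) \<longlonglongrightarrow> indicator S z" for z
  proof (cases "z \<in> S")
    case True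
    then show ?thesis by (simp add: G_def)
  next
    case False
    then have d: "0 < infdist z S"
      using in_closed_iff_infdist_zero[OF S] infdist_nonneg[of z S] by (metis order_less_le)
    have "\<forall>\<^sub>F k in sequentially. G k z = 0"
      using eventually_ge_at_top[of "nat \<lceil>1 / infdist z S\<rceil>"]
    proof eventually_elim
      case (elim k)
      then have "1 / infdist z S \<le> real k" by linarith
      then have "1 \<le> real k * infdist z S" using d by (simp add: divide_le_eq)
      then show ?case by (simp add: G_def)
    qed
    then show ?thesis using False by (simp add: tendsto_eventually)
  qed
  then have "(\<lambda>k. \<integral>s. G k (circle_pt s) \<partial>unit_unif) \<longlonglongrightarrow> (\<integral>s. indicator S (circle_pt s) \<partial>unit_unif)"
    by (intro integral_dominated_convergence[where w = "\<lambda>_. 1"]) (auto simp: G01)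
  moreover have "(\<integral>s. indicator S (circle_pt s) \<partial>unit_unif) \<le> b - a"
  proof -
    have "(\<integral>s. indicator S (circle_pt s) \<partial>unit_unif) = (\<integral>s. indicator (circle_pt -` S) s \<partial>unit_unif)"
      by (intro Bochner_Integration.integral_cong) (auto simp: indicator_def)
    also have "\<dots> = measure unit_unif (circle_pt -` S)"
      by (simp add: unit_unif_def)
    also have "\<dots> = measure lborel ({0..1} \<inter> circle_pt -` S)"
    proof -
      have "circle_pt -` S \<in> sets lborel" using measurable_sets[OF circle_pt_measurable, of S] by simp
      then show ?thesis by (simp add: unit_unif_def measure_uniform_measure)
    qed
    also have "\<dots> \<le> measure lborel ({a..b} \<union> {0, 1})"
    proof (intro measure_mono_fmeasurable)
      show "{0..1} \<inter> circle_pt -` S \<subseteq> {a..b} \<union> {0, 1}"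
      proof
        fix s assume "s \<in> {0..1} \<inter> circle_pt -` S"
        then obtain s' where s: "0 \<le> s" "s \<le> 1" "s' \<in> {a..b}" "circle_pt s = circle_pt s'" by (auto simp: S_def)
        then obtain k :: int where k: "s = s' + of_int k" by (auto simp: circle_pt_eq_iff)
        then have "\<bar>of_int k :: real\<bar> \<le> 1" using s ab by auto
        then have "k = 0 \<or> k = 1 \<or> k = -1" by linarith
        then show "s \<in> {a..b} \<union> {0, 1}" using k s ab by auto
      qed
      show "{0..1} \<inter> circle_pt -` S \<in> sets lborel"
        using measurable_sets[OF circle_pt_measurable, of S] by simp
      show "{a..b} \<union> {0, 1} \<in> fmeasurable lborel" by (intro fmeasurable.Un) (auto intro: fmeasurable_compact)
    qed
    also have "\<dots> \<le> measure lborel {a..b} + measure lborel {0, 1::real}"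
      by (intro measure_Un_le) auto
    also have "measure lborel {0, 1::real} = 0" by (intro measure_eq_0_null_sets countable_imp_null_set_lborel) auto
    finally show ?thesis using ab by simp
  qed
  ultimately have "\<forall>\<^sub>F k in sequentially. (\<integral>s. G k (circle_pt s) \<partial>unit_unif) < (b - a) + e / 2"
    using e by (intro order_tendstoD(2)) auto
  then obtain k where k: "(\<integral>s. G k (circle_pt s) \<partial>unit_unif) < (b - a) + e / 2"
    by (auto simp: eventually_sequentially)
  have "\<forall>\<^sub>F N in sequentially. (\<Sum>n=1..N. G k (circle_pt (t n))) \<le> real N * ((\<integral>s. G k (circle_pt s) \<partial>unit_unif) + e / 2)"
    using e by (intro continuous_averages_upper Gc Gi) auto
  then show ?thesis
  proof eventually_elim
    case (elim N)
    have "real (card {n\<in>{1..N}. frac (t n) \<in> {a..b}}) = (\<Sum>n\<in>{n\<in>{1..N}. frac (t n) \<in> {a..b}}. 1)" by simp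
    also have "\<dots> \<le> (\<Sum>n\<in>{n\<in>{1..N}. frac (t n) \<in> {a..b}}. G k (circle_pt (t n)))"
    proof (intro sum_mono)
      fix n assume "n \<in> {n\<in>{1..N}. frac (t n) \<in> {a..b}}"
      then have "circle_pt (frac (t n)) \<in> S" by (auto simp: S_def)
      then show "1 \<le> G k (circle_pt (t n))" by (simp add: G_def circle_pt_frac)
    qed
    also have "\<dots> \<le> (\<Sum>n=1..N. G k (circle_pt (t n)))" by (intro sum_mono2) (auto simp: G01)
    also have "\<dots> \<le> real N * ((\<integral>s. G k (circle_pt s) \<partial>unit_unif) + e / 2)" by (rule elim)
    also have "\<dots> \<le> real N * ((b - a) + e)" using k by (intro mult_left_mono) auto
    finally show ?case .
  qed
qed

text \<open>Upper bounds for closed intervals suffice: the complement of the interval with end points \<open>a\<close> and \<open>b\<close> is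
covered by \<open>{0..a}\<close> and \<open>{b..1}\<close>, whose upper bounds give the lower bound.\<close>

lemma weyl_equidistribution:
  assumes J: "is_interval J" "J \<subseteq> {0..1}"
  shows "(\<lambda>N. real (card {n\<in>{1..N}. frac (t n) \<in> J}) / real N) \<longlonglongrightarrow> measure lborel J"
proof (cases "J = {}")
  case True
  then show ?thesis by simp
next
  case False
  define a where "a = Inf J"
  define b where "b = Sup J"
  have bdd: "bdd_below J" "bdd_above J" using J(2) by (auto intro: bdd_below_mono bdd_above_mono)
  have sub: "J \<subseteq> {a..b}" using bdd by (auto simp: a_def b_def intro: cInf_lower cSup_upper)
  have ab: "0 \<le> a" "a \<le> b" "b \<le> 1"
  proof -
    show "0 \<le> a" using J(2) False by (auto simp: a_def intro!: cInf_greatest)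
    show "b \<le> 1" using J(2) False by (auto simp: b_def intro!: cSup_least)
    show "a \<le> b" using sub False by force
  qed
  have sup: "{a<..<b} \<subseteq> J"
  proof
    fix x assume x: "x \<in> {a<..<b}"
    then obtain y where y: "y \<in> J" "y < x" using cInf_lessD[OF False, of x] by (auto simp: a_def)
    obtain y' where y': "y' \<in> J" "x < y'" using x less_cSup_iff[OF False bdd(2), of x] by (auto simp: b_def)
    show "x \<in> J" using J(1) y y' unfolding is_interval_1 by (meson less_imp_le)
  qed
  have mJ: "measure lborel J = b - a"
  proof -
    have "J = {a<..<b} \<union> (J \<inter> {a, b})" using sub sup by auto
    moreover have "{a<..<b} \<union> (J \<inter> {a, b}) \<in> sets lborel"
      by (intro sets.Un) (auto intro: borel_closed finite_imp_closed)
    ultimately have Jm: "J \<in> sets lborel" by simp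
    have ab_fm: "{a..b} \<in> fmeasurable lborel" by (auto intro: fmeasurable_compact)
    have "measure lborel {a<..<b} \<le> measure lborel J"
      using fmeasurableI2[OF ab_fm sub Jm] by (intro measure_mono_fmeasurable sup) auto
    moreover have "measure lborel J \<le> measure lborel {a..b}"
      by (intro measure_mono_fmeasurable sub Jm ab_fm)
    ultimately show ?thesis using ab by simp
  qed
  define c where "c = (\<lambda>N X. real (card {n\<in>{1..N}. frac (t n) \<in> X}))"
  have mono: "c N X \<le> c N Y" if "X \<subseteq> Y" for N X Y
    unfolding c_def using that by (auto intro!: card_mono)
  have cover: "real N \<le> c N J + c N {0..a} + c N {b..1}" for N
  proof -
    have "{1..N} \<subseteq> {n\<in>{1..N}. frac (t n) \<in> J} \<union> {n\<in>{1..N}. frac (t n) \<in> {0..a}} \<union> {n\<in>{1..N}. frac (t n) \<in> {b..1}}"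
    proof
      fix n assume n: "n \<in> {1..N}"
      have "0 \<le> frac (t n)" "frac (t n) \<le> 1" using frac_lt_1[of "t n"] by (auto simp: less_imp_le)
      moreover have "frac (t n) \<in> J" if "a < frac (t n)" "frac (t n) < b" using sup that by auto
      ultimately have "frac (t n) \<in> J \<or> frac (t n) \<in> {0..a} \<or> frac (t n) \<in> {b..1}"
        by (meson atLeastAtMost_iff not_le)
      then show "n \<in> {n\<in>{1..N}. frac (t n) \<in> J} \<union> {n\<in>{1..N}. frac (t n) \<in> {0..a}} \<union> {n\<in>{1..N}. frac (t n) \<in> {b..1}}"
        using n by blast
    qed
    then have "card {1..N} \<le> card ({n\<in>{1..N}. frac (t n) \<in> J} \<union> {n\<in>{1..N}. frac (t n) \<in> {0..a}} \<union> {n\<in>{1..N}. frac (t n) \<in> {b..1}})"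
      by (intro card_mono) auto
    also have "\<dots> \<le> card ({n\<in>{1..N}. frac (t n) \<in> J} \<union> {n\<in>{1..N}. frac (t n) \<in> {0..a}}) + card {n\<in>{1..N}. frac (t n) \<in> {b..1}}"
      by (rule card_Un_le)
    also have "\<dots> \<le> (card {n\<in>{1..N}. frac (t n) \<in> J} + card {n\<in>{1..N}. frac (t n) \<in> {0..a}}) + card {n\<in>{1..N}. frac (t n) \<in> {b..1}}"
      by (intro add_right_mono card_Un_le)
    finally show ?thesis unfolding c_def by simp
  qed
  have "(\<lambda>N. c N J / real N) \<longlonglongrightarrow> b - a"
  proof (rule tendstoI)
    fix e :: real assume e: "0 < e"
    have "\<forall>\<^sub>F N in sequentially. c N {a..b} \<le> real N * ((b - a) + e / 4)"
      unfolding c_def using ab e by (intro closed_interval_count_upper) auto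
    moreover have "\<forall>\<^sub>F N in sequentially. c N {0..a} \<le> real N * ((a - 0) + e / 4)"
      unfolding c_def using ab e by (intro closed_interval_count_upper) auto
    moreover have "\<forall>\<^sub>F N in sequentially. c N {b..1} \<le> real N * ((1 - b) + e / 4)"
      unfolding c_def using ab e by (intro closed_interval_count_upper) auto
    ultimately show "\<forall>\<^sub>F N in sequentially. dist (c N J / real N) (b - a) < e"
      using eventually_gt_at_top[of 0]
    proof eventually_elim
      case (elim N)
      have "c N J \<le> real N * ((b - a) + e / 4)" using elim mono[OF sub, of N] by linarith
      moreover have "real N * ((b - a) - e / 2) \<le> c N J"
        using cover[of N] elim by (simp add: algebra_simps)
      ultimately have "c N J / real N \<le> (b - a) + e / 4" "(b - a) - e / 2 \<le> c N J / real N"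
        using elim by (simp_all add: divide_le_eq le_divide_eq mult.commute)
      then have "\<bar>c N J / real N - (b - a)\<bar> < e" using e by linarith
      then show ?case by (simp add: dist_real_def)
    qed
  qed
  then show ?thesis by (simp add: c_def mJ)
qed

end

section \<open>Fourier decay and normality of self-similar measures\<close>

text \<open>The exponent may be lowered to at most 1, as the second moment estimate requires. Almost every
point serves all bases and all frequencies at once because there are countably many of them.\<close>

lemma fourier_decay_imp_ae_normal:
  assumes M: "prob_space M" "sets M = sets borel" and \<gamma>: "0 < \<gamma>" and u0: "1 < u0" and C: "0 \<le> C"
    and decay: "\<And>u. u0 \<le> \<bar>u\<bar> \<Longrightarrow> norm (fourier_transform M u) \<le> C * ln \<bar>u\<bar> powr (- \<gamma>)"
  shows "AE x in M. \<forall>b\<ge>2. normal_to_base b x"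
proof -
  define \<gamma>' where "\<gamma>' = min 1 \<gamma>"
  have decay': "norm (fourier_transform M u) \<le> C * ln \<bar>u\<bar> powr (- \<gamma>')" if u: "max u0 (exp 1) \<le> \<bar>u\<bar>" for u
  proof -
    have "0 < \<bar>u\<bar>" "exp 1 \<le> \<bar>u\<bar>" using u u0 by auto
    then have "1 \<le> ln \<bar>u\<bar>" by (simp add: ln_ge_iff)
    then have "ln \<bar>u\<bar> powr (- \<gamma>) \<le> ln \<bar>u\<bar> powr (- \<gamma>')" by (intro powr_mono) (auto simp: \<gamma>'_def)
    then have "C * ln \<bar>u\<bar> powr (- \<gamma>) \<le> C * ln \<bar>u\<bar> powr (- \<gamma>')" using C by (rule mult_left_mono)
    then show ?thesis using decay[of u] u by simp
  qed
  have "AE x in M. \<forall>b h. 2 \<le> b \<and> h \<noteq> (0::int) \<longrightarrow>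
      (\<lambda>N. (\<Sum>n=1..N. iexp (2 * pi * (of_int h * (x * real b ^ n)))) / of_nat N) \<longlonglongrightarrow> 0"
    unfolding AE_all_countable
  proof (intro allI)
    fix b :: nat and h :: int
    show "AE x in M. 2 \<le> b \<and> h \<noteq> 0 \<longrightarrow>
      (\<lambda>N. (\<Sum>n=1..N. iexp (2 * pi * (of_int h * (x * real b ^ n)))) / of_nat N) \<longlonglongrightarrow> 0"
    proof (cases "2 \<le> b \<and> h \<noteq> 0")
      case True
      have "AE x in M. (\<lambda>N. (\<Sum>n=1..N. iexp (2 * pi * (of_int h * (x * real b ^ n)))) / of_nat N) \<longlonglongrightarrow> 0"
      proof (rule fourier_decay_imp_exponential_averages[OF M _ _ _ _ C])
        show "norm (fourier_transform M u) \<le> C * ln \<bar>u\<bar> powr (- \<gamma>')" if "max u0 (exp 1) \<le> \<bar>u\<bar>" for u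
          using that by (rule decay')
      qed (use True \<gamma> in \<open>auto simp: \<gamma>'_def\<close>)
      then show ?thesis by eventually_elim simp
    next
      case False
      then show ?thesis by (intro AE_I2) blast
    qed
  qed
  then show ?thesis
  proof eventually_elim
    case (elim x)
    show ?case
      unfolding normal_to_base_def using elim by (intro allI impI weyl_equidistribution) auto
  qed
qed

theorem theorem4p2:
  fixes m :: nat and r :: real and l :: "nat \<Rightarrow> nat" and a p :: "nat \<Rightarrow> real"
    and \<mu> :: "real measure"
  assumes "m \<ge> 2"
    and "0 < r" and "r < 1"
    and "\<And>i. i \<in> {1..m} \<Longrightarrow> l i > 0"
    and "Gcd (l ` {1..m}) = 1"
    and "\<And>i. i \<in> {1..m} \<Longrightarrow> 0 < p i \<and> p i < 1"
    and "(\<Sum>i\<in>{1..m}. p i) = 1"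
    and "is_self_similar_measure {1..m} (\<lambda>i x. r ^ l i * x + a i) p \<mu>"
    and "non_atomic \<mu>"
    and "algebraic (inverse r)"
    and "\<exists>z\<in>conjugates (complex_of_real (inverse r)).
           z \<noteq> complex_of_real (inverse r) \<and> norm z > 1"
  shows "(\<exists>\<gamma>>0. (\<lambda>u. norm (fourier_transform \<mu> u))
              \<in> O[at_infinity](\<lambda>u. ln \<bar>u\<bar> powr (- \<gamma>)))
         \<and> (AE x in \<mu>. \<forall>b\<ge>2. normal_to_base b x)"
proof -
  have \<mu>: "prob_space \<mu>" "sets \<mu> = sets borel"
    using assms(8) by (auto simp: is_self_similar_measure_def)
  have "0 < r ^ l i \<and> r ^ l i < 1" if "i \<in> {1..m}" for i
    using assms(2,3) assms(4)[OF that] by (simp add: power_less_one_iff)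
  then obtain i j where ij: "i \<in> {1..m}" "j \<in> {1..m}" "a i * (1 - r ^ l j) \<noteq> a j * (1 - r ^ l i)"
    using non_atomic_distinct_fixed_points[OF _ assms(8,9)] by blast
  define \<alpha> where "\<alpha> = a i * (1 - r ^ l j) - a j * (1 - r ^ l i)"
  have \<alpha>: "\<alpha> \<noteq> 0" using ij(3) by (simp add: \<alpha>_def)
  obtain z where z: "z \<in> conjugates (complex_of_real (inverse r))" "z \<noteq> complex_of_real (inverse r)" "norm z > 1"
    using assms(11) by blast
  have "\<exists>\<gamma>>0. \<exists>B. \<forall>w k. 1 \<le> \<bar>\<alpha> * w\<bar> \<longrightarrow> \<bar>\<alpha> * w\<bar> \<le> inverse r \<longrightarrow> 1 \<le> k \<longrightarrow>
     norm (fourier_transform \<mu> (w * inverse r ^ k)) \<le> B * real k powr (- \<gamma>)"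
    by (rule decay_along_geometric_progressions[OF _ assms(2,3,4,5) _ assms(7,8) ij(1,2) \<alpha>_def \<alpha> z])
       (use assms(6) in auto)
  then obtain \<gamma> B where \<gamma>: "0 < \<gamma>" and B: "\<And>w k. 1 \<le> \<bar>\<alpha> * w\<bar> \<Longrightarrow> \<bar>\<alpha> * w\<bar> \<le> inverse r \<Longrightarrow> 1 \<le> k \<Longrightarrow>
     norm (fourier_transform \<mu> (w * inverse r ^ k)) \<le> B * real k powr (- \<gamma>)"
    by blast
  have "1 < inverse r" using assms(2,3) by (simp add: one_less_inverse)
  then obtain C u0 where u0: "1 < u0" and C: "0 \<le> C"
    and decay: "\<And>u. u0 \<le> \<bar>u\<bar> \<Longrightarrow> norm (fourier_transform \<mu> u) \<le> C * ln \<bar>u\<bar> powr (- \<gamma>)"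
    using logarithmic_decay_from_geometric[OF _ \<alpha> \<gamma> B] by blast
  have "(\<lambda>u. norm (fourier_transform \<mu> u)) \<in> O[at_infinity](\<lambda>u. ln \<bar>u\<bar> powr (- \<gamma>))"
    by (rule bigoI[of _ C]) (use decay in \<open>auto simp: eventually_at_infinity intro!: exI[of _ u0]\<close>)
  moreover have "AE x in \<mu>. \<forall>b\<ge>2. normal_to_base b x"
    by (rule fourier_decay_imp_ae_normal[OF \<mu> \<gamma> u0 C decay])
  ultimately show ?thesis using \<gamma> by blast
qed

end
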